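(* The sample complexity of $m$-qubit quantum state tomography with a streaming algorithm is $O(18^m/\epsilon^2)$. That is, there is an absolute constant $K$ such that for every $m\ge1$ and every $\epsilon\in(0,1]$ there is a streaming algorithm which, given at most $K\cdot 18^m/\epsilon^2$ copies of an arbitrary unknown $m$-qubit state $\rho$, outputs a classical description of an $m$-qubit state $\hat\rho$ such that $\|\hat\rho-\rho\|_1\le\epsilon$ with probability at least $\tfrac23$.
   Context: An $m$-qubit state is a density operator on $(\mathbb{C}^2)^{\otimes m}$. $\|A\|_1=\operatorname{Tr}\sqrt{A^\dagger A}$. A streaming algorithm (local measurement) using $n$ copies of $\rho$ measures each qubit of each copy separately with a one-qubit POVM, all these POVMs being fixed in advance (non-adaptive), so that the overall POVM on $\rho^{\otimes n}$ is a tensor product of one-qubit POVMs; the outcomes are then processed classically. *)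

theory Defs
  imports "Jordan_Normal_Form.Schur_Decomposition" "HOL-Library.FuncSet"
begin

definition mat_trace :: "complex mat \<Rightarrow> complex" where
  "mat_trace A = (\<Sum>i<dim_row A. A $$ (i, i))"

text \<open>The order on complex numbers is the one of \<^theory>\<open>HOL-Library.Complex_Order\<close>:
  a complex number is at least zero iff it is real and nonnegative.\<close>

definition pos_semidef :: "nat \<Rightarrow> complex mat \<Rightarrow> bool" where
  "pos_semidef d A \<longleftrightarrow> A \<in> carrier_mat d d \<and> mat_adjoint A = A \<and>
     (\<forall>v \<in> carrier_vec d. 0 \<le> (A *\<^sub>v v) \<bullet>c v)"

definition density_operator :: "nat \<Rightarrow> complex mat \<Rightarrow> bool" where
  "density_operator d \<rho> \<longleftrightarrow> pos_semidef d \<rho> \<and> mat_trace \<rho> = 1"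

text \<open>The operator square root is only meaningful for positive semidefinite arguments, where
  the positive semidefinite root exists and is unique. In \<^term>\<open>trace_norm\<close> below it is
  applied to a matrix of the form \<open>A\<^sup>\<dagger> A\<close>.\<close>

definition psd_sqrt :: "complex mat \<Rightarrow> complex mat" where
  "psd_sqrt A = (THE B. pos_semidef (dim_row A) B \<and> B * B = A)"

definition trace_norm :: "complex mat \<Rightarrow> real" where
  "trace_norm A = Re (mat_trace (psd_sqrt (mat_adjoint A * A)))"

text \<open>The Kronecker product represents the tensor product of operators in the product basis,
  with the first tensor factor as the most significant digit of an index.\<close>

definition tensor_mat :: "complex mat \<Rightarrow> complex mat \<Rightarrow> complex mat" where
  "tensor_mat A B = mat (dim_row A * dim_row B) (dim_col A * dim_col B)
     (\<lambda>(i, j). A $$ (i div dim_row B, j div dim_col B) * B $$ (i mod dim_row B, j mod dim_col B))"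

definition tensor_list :: "complex mat list \<Rightarrow> complex mat" where
  "tensor_list As = foldr tensor_mat As (1\<^sub>m 1)"

text \<open>A POVM with finitely many outcomes is the list of its effects; outcome \<open>k\<close> is the
  position of an effect in the list.\<close>

definition povm :: "nat \<Rightarrow> complex mat list \<Rightarrow> bool" where
  "povm d Fs \<longleftrightarrow> (\<forall>F \<in> set Fs. pos_semidef d F) \<and> foldr (+) Fs (0\<^sub>m d d) = 1\<^sub>m d"

definition born_prob :: "complex mat \<Rightarrow> complex mat \<Rightarrow> real" where
  "born_prob F \<sigma> = Re (mat_trace (F * \<sigma>))"

text \<open>In the following, \<open>E i j\<close> is the POVM applied to qubit \<open>j\<close> of copy \<open>i\<close>, where
  \<open>j < m\<close> and \<open>i < n\<close>. As \<open>E\<close> does not depend on any measurement outcome, the measurement is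
  non-adaptive. A joint outcome \<open>w\<close> records the outcome \<open>w i j\<close> of every single POVM.\<close>

definition joint_outcomes ::
    "nat \<Rightarrow> nat \<Rightarrow> (nat \<Rightarrow> nat \<Rightarrow> complex mat list) \<Rightarrow> (nat \<Rightarrow> nat \<Rightarrow> nat) set" where
  "joint_outcomes m n E = (\<Pi>\<^sub>E i \<in> {..<n}. \<Pi>\<^sub>E j \<in> {..<m}. {..<length (E i j)})"

definition joint_effect ::
    "nat \<Rightarrow> nat \<Rightarrow> (nat \<Rightarrow> nat \<Rightarrow> complex mat list) \<Rightarrow> (nat \<Rightarrow> nat \<Rightarrow> nat) \<Rightarrow> complex mat" where
  "joint_effect m n E w =
     tensor_list (map (\<lambda>i. tensor_list (map (\<lambda>j. E i j ! w i j) [0..<m])) [0..<n])"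

definition streaming_prob ::
    "nat \<Rightarrow> nat \<Rightarrow> (nat \<Rightarrow> nat \<Rightarrow> complex mat list) \<Rightarrow> complex mat \<Rightarrow>
      ((nat \<Rightarrow> nat \<Rightarrow> nat) \<Rightarrow> bool) \<Rightarrow> real" where
  "streaming_prob m n E \<rho> P =
     (\<Sum>w \<in> {w \<in> joint_outcomes m n E. P w}.
        born_prob (joint_effect m n E w) (tensor_list (replicate n \<rho>)))"

text \<open>A streaming algorithm for tomography consists of the one-qubit POVMs \<open>E\<close> and a
  post-processing function \<open>est\<close>, which maps every joint outcome to an \<open>m\<close>-qubit state.\<close>

definition streaming_tomography_algorithm ::
    "nat \<Rightarrow> nat \<Rightarrow> (nat \<Rightarrow> nat \<Rightarrow> complex mat list) \<Rightarrow>
      ((nat \<Rightarrow> nat \<Rightarrow> nat) \<Rightarrow> complex mat) \<Rightarrow> bool" where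
  "streaming_tomography_algorithm m n E est \<longleftrightarrow>
     (\<forall>i<n. \<forall>j<m. povm 2 (E i j)) \<and>
     (\<forall>w \<in> joint_outcomes m n E. density_operator (2 ^ m) (est w))"

end

theory Submission
  imports Defs "Jordan_Normal_Form.Jordan_Normal_Form_Existence" "HOL-Analysis.Convex"
begin

text \<open>Every qubit is measured with the six-outcome POVM formed by the eigenprojections of the three
  Pauli matrices, divided by \<open>3\<close>. If \<open>F\<^sub>k\<close> are its effects and \<open>D\<^sub>k = 9 F\<^sub>k - 1\<close>, then
  \<open>\<Sum>\<^sub>k Tr (F\<^sub>k \<sigma>) D\<^sub>k = \<sigma>\<close>, so the tensor product of the observed \<open>D\<^sub>k\<close> is an unbiased estimator of
  \<open>\<rho>\<close>; its squared Frobenius norm is \<open>5\<^sup>m\<close>. The mean over \<open>n\<close> copies therefore has expected squared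
  Frobenius error at most \<open>5\<^sup>m / n\<close>. Since the squared trace norm is at most \<open>2\<^sup>m\<close> times the squared
  Frobenius norm, Markov's inequality shows that \<open>O(10\<^sup>m / \<epsilon>\<^sup>2)\<close> copies suffice, after replacing the
  mean by a nearby state.\<close>

section \<open>Trace norm and Frobenius norm\<close>

text \<open>\<open>trace_norm\<close> rests on a definite description, so nothing can be said about
  it until the positive semidefinite root of \<open>A * A\<close> is known to exist and to be
  unique. Only Hermitian \<open>A\<close> occur, being differences of two states; for these,
  existence comes from the Jordan form and uniqueness from a trace argument. The linear inversion
  estimator is unbiased because the six eigenprojections form a 2-design: the sum of F_k tensor D_k
  is the swap operator, which fixes the coefficients 9 and -1 of the duals. All error estimates use
  the squared Frobenius norm, since it splits into matrix entries, each a mean of independent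
  samples. The base 10 = 2 * 5 is the dimension factor times the second moment per qubit. It lies
  below the base 18 of the claim, so a crude Markov bound with constant success probability leaves
  room to spare.\<close>

definition frobenius_sq :: "complex mat \<Rightarrow> real" where
  "frobenius_sq A = (\<Sum>i<dim_row A. \<Sum>j<dim_col A. (cmod (A $$ (i, j)))\<^sup>2)"

lemma mat_adjoint_dim [simp]:
  "dim_row (mat_adjoint A) = dim_col A" "dim_col (mat_adjoint A) = dim_row A"
  by (auto simp: mat_adjoint_def)

lemma mat_adjoint_carrier [simp]:
  "A \<in> carrier_mat n m \<Longrightarrow> mat_adjoint A \<in> carrier_mat m n"
  by (metis carrier_matD carrier_matI mat_adjoint_dim)

lemma mat_adjoint_index [simp]:
  fixes A :: "complex mat"
  assumes "i < dim_col A" "j < dim_row A"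
  shows "mat_adjoint A $$ (i, j) = cnj (A $$ (j, i))"
  using assms by (simp add: mat_adjoint_def mat_of_rows_def)

lemma index_mult_mat_sum:
  assumes "A \<in> carrier_mat n m" "B \<in> carrier_mat m l" "i < n" "j < l"
  shows "(A * B) $$ (i, j) = (\<Sum>k<m. A $$ (i, k) * B $$ (k, j))"
  using assms by (auto simp: scalar_prod_def lessThan_atLeast0)

lemma mat_adjoint_adjoint [simp]: "mat_adjoint (mat_adjoint A) = (A :: complex mat)"
  by (rule eq_matI) auto

lemma mat_adjoint_mult:
  fixes A B :: "complex mat"
  assumes "A \<in> carrier_mat n m" "B \<in> carrier_mat m l"
  shows "mat_adjoint (A * B) = mat_adjoint B * mat_adjoint A"
proof (rule eq_matI)
  fix i j
  assume "i < dim_row (mat_adjoint B * mat_adjoint A)" "j < dim_col (mat_adjoint B * mat_adjoint A)"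
  then have ij: "i < l" "j < n" using assms by auto
  have "mat_adjoint (A * B) $$ (i, j) = cnj ((A * B) $$ (j, i))"
    using ij assms by (intro mat_adjoint_index) auto
  also have "\<dots> = (\<Sum>k<m. mat_adjoint B $$ (i, k) * mat_adjoint A $$ (k, j))"
    using ij assms by (subst index_mult_mat_sum[OF assms]) (auto intro!: sum.cong)
  also have "\<dots> = (mat_adjoint B * mat_adjoint A) $$ (i, j)"
    using ij assms by (subst index_mult_mat_sum[of _ l m _ n]) auto
  finally show "mat_adjoint (A * B) $$ (i, j) = (mat_adjoint B * mat_adjoint A) $$ (i, j)" .
qed (use assms in auto)

lemma mat_trace_mult:
  assumes "A \<in> carrier_mat n m" "B \<in> carrier_mat m n"
  shows "mat_trace (A * B) = (\<Sum>i<n. \<Sum>j<m. A $$ (i, j) * B $$ (j, i))"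
  using assms by (auto simp: mat_trace_def index_mult_mat_sum[OF assms] simp del: index_mult_mat(1))

lemma mat_trace_comm:
  assumes "A \<in> carrier_mat n m" "B \<in> carrier_mat m n"
  shows "mat_trace (A * B) = mat_trace (B * A)"
  unfolding mat_trace_mult[OF assms] mat_trace_mult[OF assms(2,1)]
  by (subst sum.swap) (simp add: mult.commute)

lemma mat_trace_add:
  assumes "A \<in> carrier_mat n n" "B \<in> carrier_mat n n"
  shows "mat_trace (A + B) = mat_trace A + mat_trace B"
  using assms by (simp add: mat_trace_def sum.distrib)

text \<open>Since entry (j, i) is the conjugate of entry (i, j), the products in the trace are
  squared moduli. Hence Hermitian matrices with equal squares have equal Frobenius norm, and the
  norm inherits the multiplicativity of the trace under tensor products.\<close>

lemma frobenius_sq_hermitian: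
  assumes "A \<in> carrier_mat n n" "mat_adjoint A = A"
  shows "mat_trace (A * A) = complex_of_real (frobenius_sq A)"
proof -
  have *: "A $$ (i, j) * A $$ (j, i) = complex_of_real ((cmod (A $$ (i, j)))\<^sup>2)"
    if "i < n" "j < n" for i j
  proof -
    have "A $$ (j, i) = cnj (A $$ (i, j))"
      using mat_adjoint_index[of j A i] that assms by simp
    then show ?thesis by (simp only: complex_norm_square)
  qed
  have dims: "dim_row A = n" "dim_col A = n" using assms by auto
  show ?thesis
    unfolding mat_trace_mult[OF assms(1) assms(1)] frobenius_sq_def dims of_real_sum
    by (intro sum.cong refl *) auto
qed

text \<open>A triangle inequality for squared norms: the factor 2 is the price for avoiding square
  roots.\<close>

lemma frobenius_sq_add_le:
  assumes "A \<in> carrier_mat n m" "B \<in> carrier_mat n m"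
  shows "frobenius_sq (A + B) \<le> 2 * frobenius_sq A + 2 * frobenius_sq B"
proof -
  have *: "(cmod (x + y))\<^sup>2 \<le> 2 * (cmod x)\<^sup>2 + 2 * (cmod y)\<^sup>2" for x y
  proof -
    have "(cmod (x + y))\<^sup>2 \<le> (cmod x + cmod y)\<^sup>2"
      by (intro power_mono norm_triangle_ineq) auto
    also have "\<dots> \<le> 2 * (cmod x)\<^sup>2 + 2 * (cmod y)\<^sup>2"
      using zero_le_power2[of "cmod x - cmod y"] by (simp add: power2_eq_square algebra_simps)
    finally show ?thesis .
  qed
  have "frobenius_sq (A + B) = (\<Sum>i<n. \<Sum>j<m. (cmod (A $$ (i, j) + B $$ (i, j)))\<^sup>2)"
    using assms by (auto simp: frobenius_sq_def)
  also have "\<dots> \<le> (\<Sum>i<n. \<Sum>j<m. 2 * (cmod (A $$ (i, j)))\<^sup>2 + 2 * (cmod (B $$ (i, j)))\<^sup>2)"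
    by (intro sum_mono *)
  also have "\<dots> = 2 * frobenius_sq A + 2 * frobenius_sq B"
    using assms by (auto simp: frobenius_sq_def sum.distrib sum_distrib_left)
  finally show ?thesis .
qed

lemma sesquilinear_sum:
  fixes A :: "complex mat"
  assumes "A \<in> carrier_mat n n" "v \<in> carrier_vec n" "w \<in> carrier_vec n"
  shows "(A *\<^sub>v v) \<bullet>c w = (\<Sum>i<n. \<Sum>j<n. A $$ (i, j) * v $ j * cnj (w $ i))"
  using assms by (auto simp: scalar_prod_def lessThan_atLeast0 sum_distrib_right intro!: sum.cong)

text \<open>Moving one factor across the inner product turns the form at \<open>v\<close> into the
  squared length of \<open>S *\<^sub>v v\<close>. Positivity of the root built later is obtained by
  writing it as such a square.\<close>

lemma pos_semidef_square:
  assumes S: "S \<in> carrier_mat n n" "mat_adjoint S = S"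
  shows "pos_semidef n (S * S)"
  unfolding pos_semidef_def
proof (intro conjI ballI)
  show "mat_adjoint (S * S) = S * S"
    using S mat_adjoint_mult[OF S(1) S(1)] by simp
  fix v :: "complex vec" assume v: "v \<in> carrier_vec n"
  have h: "cnj (S $$ (j, i)) = S $$ (i, j)" if "i < n" "j < n" for i j
    using mat_adjoint_index[of i S j] that S by simp
  have "((S * S) *\<^sub>v v) \<bullet>c v = (S *\<^sub>v (S *\<^sub>v v)) \<bullet>c v"
    using S v by simp
  also have "\<dots> = (\<Sum>i<n. \<Sum>j<n. S $$ (i, j) * (S *\<^sub>v v) $ j * cnj (v $ i))"
    using S v by (intro sesquilinear_sum) auto
  also have "\<dots> = (\<Sum>j<n. (S *\<^sub>v v) $ j * cnj (\<Sum>i<n. S $$ (j, i) * v $ i))"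
    by (subst sum.swap) (auto simp: sum_distrib_left h intro!: sum.cong)
  also have "\<dots> = (\<Sum>j<n. (S *\<^sub>v v) $ j * cnj ((S *\<^sub>v v) $ j))"
    using S v by (auto simp: scalar_prod_def lessThan_atLeast0 intro!: sum.cong)
  also have "0 \<le> \<dots>"
    by (intro sum_nonneg) (auto simp: less_eq_complex_def complex_norm_square[symmetric])
  finally show "0 \<le> ((S * S) *\<^sub>v v) \<bullet>c v" .
qed (use S in auto)

section \<open>Diagonalisation of Hermitian matrices through the Jordan form\<close>

text \<open>A nonzero superdiagonal entry lies inside a single Jordan block, where the diagonal is
  constant. Splitting off the first block reduces all other positions to the tail, with indices
  shifted by the block size.\<close>

lemma jordan_matrix_index_cases:
  assumes "i < sum_list (map fst bs)" "j < sum_list (map fst bs)"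
  shows "(i \<noteq> j \<and> Suc i \<noteq> j \<longrightarrow> jordan_matrix bs $$ (i, j) = 0) \<and>
    (Suc i = j \<and> jordan_matrix bs $$ (i, j) \<noteq> 0 \<longrightarrow>
       jordan_matrix bs $$ (i, i) = jordan_matrix bs $$ (j, j))"
  using assms
proof (induction bs arbitrary: i j)
  case Nil
  then show ?case by simp
next
  case (Cons b bs)
  obtain k a where b: "b = (k, a)" by force
  have J: "jordan_matrix (b # bs) =
      four_block_mat (jordan_block k a) (0\<^sub>m k (sum_list (map fst bs)))
        (0\<^sub>m (sum_list (map fst bs)) k) (jordan_matrix bs)"
    using jordan_matrix_dim[of bs, unfolded jordan_matrix_def]
    by (simp add: jordan_matrix_def b Let_def)
  let ?s = "sum_list (map fst bs)"
  have ij: "i < k + ?s" "j < k + ?s" using Cons.prems by (auto simp: b)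
  have idx: "jordan_matrix (b # bs) $$ (p, q) =
      (if p < k then if q < k then if p = q then a else if Suc p = q then 1 else 0 else 0
       else if q < k then 0 else jordan_matrix bs $$ (p - k, q - k))" if "p < k + ?s" "q < k + ?s" for p q
    unfolding J using that by (subst index_mat_four_block) auto
  show ?case
  proof (cases "i < k \<or> j < k")
    case True
    then show ?thesis using ij by (auto simp: idx)
  next
    case False
    then have "i - k < ?s" "j - k < ?s" "Suc i = j \<longleftrightarrow> Suc (i - k) = j - k" "i = j \<longleftrightarrow> i - k = j - k"
      using ij by auto
    with False Cons.IH[of "i - k" "j - k"] ij show ?thesis by (simp add: idx)
  qed
qed

definition diag_of :: "nat \<Rightarrow> (nat \<Rightarrow> complex) \<Rightarrow> complex mat" where
  "diag_of n f = mat n n (\<lambda>(i, j). if i = j then f i else 0)"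

lemma diag_of_carrier [simp]: "diag_of n f \<in> carrier_mat n n"
  by (simp add: diag_of_def)

lemma diag_of_dim [simp]: "dim_row (diag_of n f) = n" "dim_col (diag_of n f) = n"
  by (simp_all add: diag_of_def)

lemma mult_diag_of_index:
  assumes "A \<in> carrier_mat n n" "i < n" "j < n"
  shows "(A * diag_of n f) $$ (i, j) = A $$ (i, j) * f j"
proof -
  have "(A * diag_of n f) $$ (i, j) = (\<Sum>k<n. if k = j then A $$ (i, k) * f k else 0)"
    unfolding index_mult_mat_sum[OF assms(1) diag_of_carrier assms(2,3)]
    using assms by (intro sum.cong) (auto simp: diag_of_def)
  then show ?thesis using assms by simp
qed

lemma diag_of_mult: "diag_of n f * diag_of n g = diag_of n (\<lambda>i. f i * g i)"
proof (rule eq_matI)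
  fix i j assume "i < dim_row (diag_of n (\<lambda>i. f i * g i))" "j < dim_col (diag_of n (\<lambda>i. f i * g i))"
  then have ij: "i < n" "j < n" by auto
  show "(diag_of n f * diag_of n g) $$ (i, j) = diag_of n (\<lambda>i. f i * g i) $$ (i, j)"
    unfolding mult_diag_of_index[OF diag_of_carrier ij] using ij by (simp add: diag_of_def)
qed auto

lemma hermitian_index:
  fixes A :: "complex mat"
  assumes "A \<in> carrier_mat n n" "mat_adjoint A = A" "i < n" "j < n"
  shows "cnj (A $$ (j, i)) = A $$ (i, j)"
  using mat_adjoint_index[of i A j] assms by simp

text \<open>The diagonal entry is the squared length of column \<open>i\<close> of \<open>P\<close>.
  If it vanished, so would that column, and with it entry (i, i) of \<open>Q * P\<close>.\<close>

lemma gram_diag_nonzero: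
  fixes P :: "complex mat"
  assumes P: "P \<in> carrier_mat n n" and Q: "Q \<in> carrier_mat n n" and QP: "Q * P = 1\<^sub>m n" and i: "i < n"
  shows "(mat_adjoint P * P) $$ (i, i) \<noteq> 0"
proof
  assume "(mat_adjoint P * P) $$ (i, i) = 0"
  also have "(mat_adjoint P * P) $$ (i, i) = (\<Sum>k<n. complex_of_real ((cmod (P $$ (k, i)))\<^sup>2))"
    unfolding index_mult_mat_sum[OF mat_adjoint_carrier[OF P] P i i]
  proof (intro sum.cong refl)
    fix k assume "k \<in> {..<n}"
    then have "mat_adjoint P $$ (i, k) = cnj (P $$ (k, i))"
      using P i by (intro mat_adjoint_index) auto
    then show "mat_adjoint P $$ (i, k) * P $$ (k, i) = complex_of_real ((cmod (P $$ (k, i)))\<^sup>2)"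
      by (simp only: complex_norm_square mult.commute)
  qed
  finally have "(\<Sum>k<n. (cmod (P $$ (k, i)))\<^sup>2) = 0"
    unfolding of_real_sum[symmetric] of_real_eq_0_iff .
  then have "P $$ (k, i) = 0" if "k < n" for k
    using that by (subst (asm) sum_nonneg_eq_0_iff) auto
  then have "(Q * P) $$ (i, i) = 0"
    unfolding index_mult_mat_sum[OF Q P i i] by (intro sum.neutral) auto
  then show False using QP i by simp
qed

text \<open>The Gram matrix \<open>G = P\<^sup>\<dagger> P\<close> turns the Jordan form \<open>J = P\<^sup>-\<^sup>1 A P\<close> into the Hermitian
  matrix \<open>G J = P\<^sup>\<dagger> A P\<close>. Comparing entries \<open>(i, i + 1)\<close> and \<open>(i + 1, i)\<close> at the first
  nonzero superdiagonal entry of \<open>J\<close> gives \<open>G\<^sub>i\<^sub>i = 0\<close>, so there is none.\<close>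

lemma hermitian_diagonalization:
  fixes A :: "complex mat"
  assumes A: "A \<in> carrier_mat n n" and herm: "mat_adjoint A = A"
  obtains P Q and d :: "nat \<Rightarrow> real"
  where "P \<in> carrier_mat n n" "Q \<in> carrier_mat n n" "P * Q = 1\<^sub>m n" "Q * P = 1\<^sub>m n"
    "A = P * diag_of n (\<lambda>i. of_real (d i)) * Q"
    "\<And>i j. i < n \<Longrightarrow> j < n \<Longrightarrow> (mat_adjoint P * P) $$ (i, j) = 0 \<or> d i = d j"
proof -
  obtain es where "char_poly A = (\<Prod>a\<leftarrow>es. [:- a, 1:])"
    using char_poly_factorized[OF A] by auto
  from jordan_nf_exists[OF A this] obtain bs P Q where
    wit: "similar_mat_wit A (jordan_matrix bs) P Q"
    unfolding jordan_nf_def similar_mat_def by blast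
  define J where "J = jordan_matrix bs"
  note w = similar_mat_witD2[OF A wit, folded J_def]
  have PQ: "P * Q = 1\<^sub>m n" and QP: "Q * P = 1\<^sub>m n" and AJ: "A = P * J * Q"
    and J: "J \<in> carrier_mat n n" and P: "P \<in> carrier_mat n n" and Q: "Q \<in> carrier_mat n n"
    using w by auto
  have n: "sum_list (map fst bs) = n" using J by (auto simp: J_def)
  have J0: "J $$ (i, j) = 0" if "i < n" "j < n" "i \<noteq> j" "Suc i \<noteq> j" for i j
    using jordan_matrix_index_cases[of i bs j] that by (auto simp: n J_def)
  have J1: "J $$ (i, i) = J $$ (Suc i, Suc i)" if "Suc i < n" "J $$ (i, Suc i) \<noteq> 0" for i
    using jordan_matrix_index_cases[of i bs "Suc i"] that by (auto simp: n J_def)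
  define G where "G = mat_adjoint P * P"
  have G: "G \<in> carrier_mat n n" unfolding G_def by (rule mult_carrier_mat[OF mat_adjoint_carrier[OF P] P])
  have aP: "mat_adjoint P \<in> carrier_mat n n" using P by (rule mat_adjoint_carrier)
  have Gherm: "mat_adjoint G = G"
    unfolding G_def using mat_adjoint_mult[OF aP P] by simp
  have "A * P = P * J * (Q * P)" unfolding AJ using P J Q by (simp add: assoc_mult_mat[of _ n n _ n _ n])
  then have AP: "A * P = P * J" unfolding QP using P J by simp
  have GJ: "G * J = mat_adjoint P * (A * P)"
    unfolding AP G_def using assoc_mult_mat[OF aP P J] .
  have "mat_adjoint (G * J) = mat_adjoint P * A * P"
    unfolding GJ using mat_adjoint_mult[OF aP mult_carrier_mat[OF A P]] mat_adjoint_mult[OF A P]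
    by (simp add: herm)
  then have GJherm: "mat_adjoint (G * J) = G * J"
    unfolding GJ using assoc_mult_mat[OF aP A P] by simp
  have GJc: "G * J \<in> carrier_mat n n" using G J by simp
  have Gii: "G $$ (i, i) \<noteq> 0" if "i < n" for i
    unfolding G_def by (rule gram_diag_nonzero[OF P Q QP that])
  have diag_col: "(G * J) $$ (i, j) = G $$ (i, j) * J $$ (j, j)"
    if "i < n" "j < n" "\<And>k. k < n \<Longrightarrow> k \<noteq> j \<Longrightarrow> J $$ (k, j) = 0" for i j
  proof -
    have "(G * J) $$ (i, j) = (\<Sum>k<n. if k = j then G $$ (i, k) * J $$ (k, j) else 0)"
      unfolding index_mult_mat_sum[OF G J that(1,2)] using that(3) by (intro sum.cong) auto
    then show ?thesis using that by simp
  qed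
  \<comment> \<open>A column of \<open>J\<close> with only its diagonal entry makes entry (i, i) of
    the Hermitian \<open>G * J\<close> equal to the real nonzero \<open>G $$ (i, i)\<close> times
    that entry, which must then be real.\<close>
  have real_col: "cnj (J $$ (i, i)) = J $$ (i, i)"
    if "i < n" "\<And>k. k < n \<Longrightarrow> k \<noteq> i \<Longrightarrow> J $$ (k, i) = 0" for i
  proof -
    have dc: "(G * J) $$ (i, i) = G $$ (i, i) * J $$ (i, i)"
      using that by (intro diag_col) auto
    have "cnj (G $$ (i, i)) * cnj (J $$ (i, i)) = G $$ (i, i) * J $$ (i, i)"
      using hermitian_index[OF GJc GJherm that(1) that(1)] unfolding dc complex_cnj_mult .
    then show ?thesis
      using hermitian_index[OF G Gherm that(1) that(1)] Gii[OF that(1)] by simp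
  qed
  have super0: "J $$ (i, Suc i) = 0" if "Suc i < n" for i
    using that
  proof (induction i rule: less_induct)
    case (less i)
    have i: "i < n" "Suc i < n" using less.prems by auto
    \<comment> \<open>The induction hypothesis removes the superdiagonal entry above position (i,
      i), so column \<open>i\<close> is already diagonal and \<open>real_col\<close> applies to
      it.\<close>
    have col: "J $$ (k, i) = 0" if "k < n" "k \<noteq> i" for k
      using less.IH[of k] J0[of k i] that i by (cases "Suc k = i") auto
    have "(G * J) $$ (i, Suc i) =
        (\<Sum>k<n. (if k = i then G $$ (i, i) * J $$ (i, Suc i) else 0) +
               (if k = Suc i then G $$ (i, Suc i) * J $$ (Suc i, Suc i) else 0))"
      unfolding index_mult_mat_sum[OF G J i] using J0 i by (intro sum.cong) auto
    also have "\<dots> = G $$ (i, i) * J $$ (i, Suc i) + G $$ (i, Suc i) * J $$ (Suc i, Suc i)"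
      using i by (simp add: sum.distrib)
    finally have 1: "(G * J) $$ (i, Suc i) = \<dots>" .
    have "(G * J) $$ (i, Suc i) = cnj ((G * J) $$ (Suc i, i))"
      using hermitian_index[OF GJc GJherm i] by simp
    also have "(G * J) $$ (Suc i, i) = G $$ (Suc i, i) * J $$ (i, i)"
      using i col by (intro diag_col) auto
    also have "cnj \<dots> = G $$ (i, Suc i) * J $$ (i, i)"
      using real_col[OF i(1) col] hermitian_index[OF G Gherm i] by simp
    finally have 2: "G $$ (i, i) * J $$ (i, Suc i) + G $$ (i, Suc i) * J $$ (Suc i, Suc i) =
        G $$ (i, Suc i) * J $$ (i, i)" unfolding 1 .
    show ?case
    proof (rule ccontr)
      assume nz: "J $$ (i, Suc i) \<noteq> 0"
      with 2 J1[OF i(2) nz] Gii[OF i(1)] show False by simp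
    qed
  qed
  have J_off: "J $$ (k, i) = 0" if "k < n" "i < n" "k \<noteq> i" for k i
    using super0[of k] J0[of k i] that by (cases "Suc k = i") auto
  define d where "d i = Re (J $$ (i, i))" for i
  have Jd: "J $$ (i, i) = of_real (d i)" if "i < n" for i
  proof -
    have "cnj (J $$ (i, i)) = J $$ (i, i)"
      using J_off that by (intro real_col) auto
    then show ?thesis by (simp add: d_def complex_eq_iff)
  qed
  have JD: "J = diag_of n (\<lambda>i. of_real (d i))"
    by (rule eq_matI) (use J Jd J_off in \<open>auto simp: diag_of_def\<close>)
  \<comment> \<open>Eigenvectors for different eigenvalues are orthogonal: comparing the Hermitian
    \<open>G * J\<close> with its adjoint leaves \<open>G $$ (i, j)\<close> times the difference of
    two real eigenvalues equal to zero.\<close>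
  have comm: "G $$ (i, j) = 0 \<or> d i = d j" if ij: "i < n" "j < n" for i j
  proof -
    have "(G * J) $$ (i, j) = cnj ((G * J) $$ (j, i))"
      using hermitian_index[OF GJc GJherm ij] by simp
    then have "G $$ (i, j) * d j = cnj (G $$ (j, i)) * d i"
      unfolding JD mult_diag_of_index[OF G ij] mult_diag_of_index[OF G ij(2,1)] by simp
    then have "G $$ (i, j) * d j = G $$ (i, j) * d i"
      using hermitian_index[OF G Gherm ij] by simp
    then show ?thesis by auto
  qed
  show thesis
    using that[OF P Q PQ QP] AJ comm unfolding JD G_def by blast
qed

section \<open>Existence of the positive semidefinite root\<close>

lemma conj_mult_conj:
  assumes "P \<in> carrier_mat n n" "Q \<in> carrier_mat n n" "X \<in> carrier_mat n n" "Y \<in> carrier_mat n n"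
    and "Q * P = 1\<^sub>m n"
  shows "(P * X * Q) * (P * Y * Q) = P * (X * Y) * (Q :: 'a :: comm_ring_1 mat)"
proof -
  have "(P * X * Q) * (P * Y * Q) = P * X * (Q * P) * Y * Q"
    using assms(1-4) by (simp add: assoc_mult_mat[of _ n n _ n _ n])
  also have "\<dots> = P * (X * Y) * Q"
    unfolding assms(5) using assms(1-4) by (simp add: assoc_mult_mat[of _ n n _ n _ n])
  finally show ?thesis .
qed

text \<open>The root is \<open>S * S\<close>, where \<open>S\<close> has the eigenvalues
  \<open>sqrt \<bar>d i\<bar>\<close>; its square has the eigenvalues of \<open>A * A\<close>. As
  \<open>P\<close> is not assumed unitary, \<open>S\<close> is not Hermitian for free: this has to
  come from the orthogonality of different eigenspaces.\<close>

lemma ex_pos_semidef_root_of_square: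
  fixes A :: "complex mat"
  assumes A: "A \<in> carrier_mat n n" and herm: "mat_adjoint A = A"
  shows "\<exists>B. pos_semidef n B \<and> B * B = A * A"
proof -
  obtain P Q and d :: "nat \<Rightarrow> real" where P: "P \<in> carrier_mat n n" and Q: "Q \<in> carrier_mat n n"
    and PQ: "P * Q = 1\<^sub>m n" and QP: "Q * P = 1\<^sub>m n"
    and AD: "A = P * diag_of n (\<lambda>i. of_real (d i)) * Q"
    and comm: "\<And>i j. i < n \<Longrightarrow> j < n \<Longrightarrow> (mat_adjoint P * P) $$ (i, j) = 0 \<or> d i = d j"
    by (rule hermitian_diagonalization[OF A herm]) blast
  define r where "r i = complex_of_real (sqrt \<bar>d i\<bar>)" for i
  define R where "R = diag_of n r"
  define S where "S = P * R * Q"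
  define G where "G = mat_adjoint P * P"
  have aP: "mat_adjoint P \<in> carrier_mat n n" and aQ: "mat_adjoint Q \<in> carrier_mat n n"
    using P Q by (auto intro: mat_adjoint_carrier)
  have R: "R \<in> carrier_mat n n" by (simp add: R_def)
  have S: "S \<in> carrier_mat n n" unfolding S_def using P Q R by simp
  have G: "G \<in> carrier_mat n n" unfolding G_def by (rule mult_carrier_mat[OF aP P])
  have GR: "G * R \<in> carrier_mat n n" using G R by simp
  have "mat_adjoint G = G"
    unfolding G_def using mat_adjoint_mult[OF aP P] by simp
  note Gh = hermitian_index[OF G this]
  \<comment> \<open>\<open>R\<close> depends only on the eigenvalue, and \<open>G\<close> is zero
    between different eigenvalues, so scaling columns of \<open>G\<close> by \<open>r\<close> is the
    same as scaling rows.\<close>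
  have GRherm: "mat_adjoint (G * R) = G * R"
  proof (rule eq_matI)
    fix i j assume "i < dim_row (G * R)" "j < dim_col (G * R)"
    then have ij: "i < n" "j < n" using GR by auto
    have "mat_adjoint (G * R) $$ (i, j) = cnj ((G * R) $$ (j, i))"
      using ij GR by (intro mat_adjoint_index) auto
    also have "\<dots> = G $$ (i, j) * r i"
      unfolding R_def mult_diag_of_index[OF G ij(2,1)] using Gh[OF ij] by (simp add: r_def)
    also have "\<dots> = G $$ (i, j) * r j"
      using comm[OF ij] by (auto simp: r_def G_def)
    also have "\<dots> = (G * R) $$ (i, j)"
      unfolding R_def mult_diag_of_index[OF G ij] ..
    finally show "mat_adjoint (G * R) $$ (i, j) = (G * R) $$ (i, j)" .
  qed (use G R in auto)
  have one: "mat_adjoint Q * mat_adjoint P = 1\<^sub>m n"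
  proof -
    have "mat_adjoint Q * mat_adjoint P = mat_adjoint (1\<^sub>m n)"
      using mat_adjoint_mult[OF P Q] by (simp add: PQ)
    also have "\<dots> = 1\<^sub>m n" by (rule eq_matI) auto
    finally show ?thesis .
  qed
  \<comment> \<open>The adjoint of \<open>Q\<close> inverts the adjoint of \<open>P\<close>, so
    \<open>S\<close> is a congruence transform of the Hermitian \<open>G * R\<close>.\<close>
  have SGR: "S = mat_adjoint Q * (G * R) * Q"
  proof -
    have "mat_adjoint Q * (G * R) * Q = (mat_adjoint Q * mat_adjoint P) * (P * R * Q)"
    proof -
      have "Y * ((X * P) * R) * Q = (Y * X) * (P * R * Q)"
        if "X \<in> carrier_mat n n" "Y \<in> carrier_mat n n" for X Y
        using that P Q R by (simp add: assoc_mult_mat[of _ n n _ n _ n])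
      from this[OF aP aQ] show ?thesis unfolding G_def .
    qed
    then show ?thesis unfolding one S_def[symmetric] left_mult_one_mat[OF S] ..
  qed
  have Sherm: "mat_adjoint S = S"
  proof -
    have "mat_adjoint S = mat_adjoint Q * (mat_adjoint (G * R) * mat_adjoint (mat_adjoint Q))"
      unfolding SGR
      using mat_adjoint_mult[OF mult_carrier_mat[OF aQ GR] Q] mat_adjoint_mult[OF aQ GR] by simp
    also have "\<dots> = S"
      unfolding SGR GRherm using aQ GR Q by (simp add: assoc_mult_mat[of _ n n _ n _ n])
    finally show ?thesis .
  qed
  have SS: "S * S = P * (R * R) * Q"
    unfolding S_def by (rule conj_mult_conj[OF P Q R R QP])
  have "(S * S) * (S * S) = P * ((R * R) * (R * R)) * Q"
    unfolding SS by (rule conj_mult_conj[OF P Q _ _ QP]) (use R in auto)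
  also have "(R * R) * (R * R) = diag_of n (\<lambda>i. of_real (d i)) * diag_of n (\<lambda>i. of_real (d i))"
  proof -
    have "(r i * r i) * (r i * r i) = of_real (d i) * of_real (d i)" for i
      unfolding r_def of_real_mult[symmetric] by simp
    then show ?thesis unfolding R_def diag_of_mult by simp
  qed
  also have "P * (diag_of n (\<lambda>i. of_real (d i)) * diag_of n (\<lambda>i. of_real (d i))) * Q = A * A"
    unfolding AD by (rule conj_mult_conj[OF P Q _ _ QP, symmetric]) auto
  finally have "(S * S) * (S * S) = A * A" .
  with pos_semidef_square[OF S Sherm] show ?thesis by blast
qed

section \<open>Uniqueness of the positive semidefinite root\<close>

text \<open>Perturb \<open>v\<close> in the direction \<open>w = B *\<^sub>v v\<close>. The form at
  \<open>v + t w\<close> is \<open>2 * t * N + t\<^sup>2 * c\<close> with \<open>N\<close> the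
  squared length of \<open>w\<close>; a positive \<open>N\<close> would make it negative for small
  negative \<open>t\<close>.\<close>

lemma pos_semidef_kernel:
  assumes B: "pos_semidef n B" and v: "v \<in> carrier_vec n" and z: "(B *\<^sub>v v) \<bullet>c v = 0"
  shows "B *\<^sub>v v = 0\<^sub>v n"
proof -
  have Bc: "B \<in> carrier_mat n n" and Bh: "mat_adjoint B = B"
    and pos: "\<And>v. v \<in> carrier_vec n \<Longrightarrow> 0 \<le> (B *\<^sub>v v) \<bullet>c v"
    using B by (auto simp: pos_semidef_def)
  define w where "w = B *\<^sub>v v"
  have w: "w \<in> carrier_vec n" using mult_mat_vec_carrier[OF Bc v] by (simp add: w_def)
  define N where "N = (\<Sum>i<n. (cmod (w $ i))\<^sup>2)"
  define h where "h x y = (\<Sum>i<n. \<Sum>j<n. B $$ (i, j) * x j * cnj (y i))" for x y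
  have form: "(B *\<^sub>v x) \<bullet>c y = h (($) x) (($) y)" if "x \<in> carrier_vec n" "y \<in> carrier_vec n" for x y
    unfolding h_def by (rule sesquilinear_sum[OF Bc that])
  have w_idx: "w $ i = (\<Sum>j<n. B $$ (i, j) * v $ j)" if "i < n" for i
    using that Bc v by (auto simp: w_def scalar_prod_def lessThan_atLeast0)
  have N: "h (($) v) (($) w) = of_real N"
    unfolding h_def N_def of_real_sum
  proof (intro sum.cong refl)
    fix i assume "i \<in> {..<n}"
    then show "(\<Sum>j<n. B $$ (i, j) * v $ j * cnj (w $ i)) = complex_of_real ((cmod (w $ i))\<^sup>2)"
      unfolding complex_norm_square sum_distrib_right[symmetric] using w_idx[of i] by simp
  qed
  have "h (($) w) (($) v) = cnj (h (($) v) (($) w))"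
    unfolding h_def cnj_sum
    by (subst sum.swap, intro sum.cong refl)
      (use hermitian_index[OF Bc Bh] in \<open>auto simp: mult_ac\<close>)
  then have N': "h (($) w) (($) v) = of_real N" by (simp add: N)
  define c where "c = Re (h (($) w) (($) w))"
  have c: "c \<ge> 0"
    using pos[OF w] form[OF w w] by (simp add: c_def less_eq_complex_def)
  have quad: "0 \<le> 2 * t * N + t\<^sup>2 * c" for t :: real
  proof -
    let ?x = "v + of_real t \<cdot>\<^sub>v w"
    have x: "?x \<in> carrier_vec n" using v w by simp
    have "h (($) ?x) (($) ?x) = h (\<lambda>i. v $ i + of_real t * w $ i) (\<lambda>i. v $ i + of_real t * w $ i)"
      unfolding h_def using v w by (intro sum.cong refl) auto
    also have "\<dots> = h (($) v) (($) v) + of_real t * h (($) v) (($) w) + of_real t * h (($) w) (($) v)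
        + of_real (t\<^sup>2) * h (($) w) (($) w)"
      unfolding h_def sum_distrib_left sum.distrib[symmetric]
      by (intro sum.cong refl) (simp add: algebra_simps power2_eq_square)
    also have "h (($) v) (($) v) = 0" using form[OF v v] z by simp
    finally have "Re (h (($) ?x) (($) ?x)) = 2 * t * N + t\<^sup>2 * c"
      by (simp add: N N' c_def)
    moreover have "0 \<le> Re (h (($) ?x) (($) ?x))"
      using pos[OF x] form[OF x x] by (simp add: less_eq_complex_def)
    ultimately show ?thesis by simp
  qed
  have "N \<le> 0"
  proof (rule ccontr)
    assume "\<not> N \<le> 0"
    then have Npos: "N > 0" by simp
    \<comment> \<open>The denominator is \<open>c + 1\<close> rather than \<open>c\<close> because
      \<open>c\<close> may be zero.\<close>
    have "0 \<le> 2 * (- N / (c + 1)) * N + (- N / (c + 1))\<^sup>2 * c" by (rule quad)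
    also have "\<dots> = - (N\<^sup>2 * (c + 2)) / (c + 1)\<^sup>2"
      using c by (simp add: power2_eq_square divide_simps) (simp add: algebra_simps)
    also have "\<dots> < 0"
      using Npos c by (intro divide_neg_pos) auto
    finally show False by simp
  qed
  moreover have "N \<ge> 0" unfolding N_def by (intro sum_nonneg) auto
  ultimately have "N = 0" by simp
  then have "w $ i = 0" if "i < n" for i
    using that unfolding N_def by (subst (asm) sum_nonneg_eq_0_iff) auto
  then show ?thesis using w by (intro eq_vecI) (auto simp: w_def[symmetric])
qed

text \<open>Row \<open>i\<close> of a Hermitian \<open>D\<close> is the conjugate of its column
  \<open>i\<close>. This exposes the trace as a sum of values of the form of \<open>B\<close>, which
  are nonnegative once \<open>B\<close> is positive semidefinite.\<close>

lemma mat_trace_sandwich: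
  assumes D: "D \<in> carrier_mat n n" "mat_adjoint D = D" and B: "B \<in> carrier_mat n n"
  shows "mat_trace (D * (B * D)) = (\<Sum>i<n. (B *\<^sub>v col D i) \<bullet>c col D i)"
proof -
  have "mat_trace (D * (B * D)) = (\<Sum>i<n. \<Sum>k<n. D $$ (i, k) * (B * D) $$ (k, i))"
    using mat_trace_mult[OF D(1) mult_carrier_mat[OF B D(1)]] .
  also have "\<dots> = (\<Sum>i<n. (B *\<^sub>v col D i) \<bullet>c col D i)"
  proof (intro sum.cong refl)
    fix i assume "i \<in> {..<n}"
    then have i: "i < n" by simp
    have "(B *\<^sub>v col D i) \<bullet>c col D i = (\<Sum>k<n. (B *\<^sub>v col D i) $ k * cnj (col D i $ k))"
      using B D i by (auto simp: scalar_prod_def lessThan_atLeast0 simp del: index_mult_mat_vec)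
    also have "\<dots> = (\<Sum>k<n. D $$ (i, k) * (B * D) $$ (k, i))"
      using B D(1) i hermitian_index[OF D i] by (intro sum.cong refl) auto
    finally show "(\<Sum>k<n. D $$ (i, k) * (B * D) $$ (k, i)) = (B *\<^sub>v col D i) \<bullet>c col D i" ..
  qed
  finally show ?thesis .
qed

lemma frobenius_sq_eq_0:
  assumes "frobenius_sq A = 0" "i < dim_row A" "j < dim_col A"
  shows "A $$ (i, j) = 0"
proof -
  have "(\<Sum>j<dim_col A. (cmod (A $$ (i, j)))\<^sup>2) = 0"
    using assms(1,2) unfolding frobenius_sq_def
    by (subst (asm) sum_nonneg_eq_0_iff) (auto intro: sum_nonneg)
  then show ?thesis using assms(3) by (subst (asm) sum_nonneg_eq_0_iff) auto
qed

text \<open>With \<open>D = B - C\<close> one has \<open>B D + D C = B\<^sup>2 - C\<^sup>2 = 0\<close>, so the nonnegative traces of \<open>D B D\<close>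
  and \<open>D C D\<close> add up to zero.\<close>

lemma pos_semidef_root_unique:
  assumes B: "pos_semidef n B" and C: "pos_semidef n C" and eq: "B * B = C * C"
  shows "B = C"
proof -
  have Bc: "B \<in> carrier_mat n n" and Bh: "mat_adjoint B = B"
    and Cc: "C \<in> carrier_mat n n" and Ch: "mat_adjoint C = C"
    using B C by (auto simp: pos_semidef_def)
  define D where "D = B - C"
  have D: "D \<in> carrier_mat n n" unfolding D_def by (rule minus_carrier_mat[OF Cc])
  have Dh: "mat_adjoint D = D"
  proof (rule eq_matI)
    fix i j assume "i < dim_row D" "j < dim_col D"
    then have ij: "i < n" "j < n" using D by auto
    have "mat_adjoint D $$ (i, j) = cnj (D $$ (j, i))"
      using ij D by (intro mat_adjoint_index) auto
    also have "\<dots> = D $$ (i, j)"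
      using ij Bc Cc hermitian_index[OF Bc Bh ij] hermitian_index[OF Cc Ch ij] by (simp add: D_def)
    finally show "mat_adjoint D $$ (i, j) = D $$ (i, j)" .
  qed (use D in auto)
  have BD: "B * D + D * C = 0\<^sub>m n n"
  proof -
    have "B * D + D * C = (B * B - B * C) + (B * C - C * C)"
      unfolding D_def using mult_minus_distrib_mat[OF Bc Bc Cc] minus_mult_distrib_mat[OF Bc Cc Cc] by simp
    also have "\<dots> = 0\<^sub>m n n"
      unfolding eq by (rule eq_matI) (use Bc Cc in auto)
    finally show ?thesis .
  qed
  have pos: "0 \<le> (B *\<^sub>v col D i) \<bullet>c col D i" "0 \<le> (C *\<^sub>v col D i) \<bullet>c col D i" if "i < n" for i
    using B C that D by (auto simp: pos_semidef_def)
  have "mat_trace (D * (B * D)) + mat_trace (D * (C * D)) = mat_trace (D * (B * D)) + mat_trace (D * (D * C))"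
    using mat_trace_comm[OF D mult_carrier_mat[OF D Cc]] assoc_mult_mat[OF D Cc D] by simp
  also have "\<dots> = mat_trace (D * (B * D) + D * (D * C))"
    using D Bc Cc by (intro mat_trace_add[symmetric, of _ n]) auto
  also have "D * (B * D) + D * (D * C) = D * (B * D + D * C)"
    using D Bc Cc by (intro mult_add_distrib_mat[symmetric, of _ n n _ n]) auto
  also have "\<dots> = 0\<^sub>m n n" unfolding BD using D by simp
  also have "mat_trace (0\<^sub>m n n :: complex mat) = 0" by (simp add: mat_trace_def)
  finally have sum0: "(\<Sum>i<n. (B *\<^sub>v col D i) \<bullet>c col D i + (C *\<^sub>v col D i) \<bullet>c col D i) = 0"
    unfolding mat_trace_sandwich[OF D Dh Bc] mat_trace_sandwich[OF D Dh Cc] by (simp add: sum.distrib)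
  \<comment> \<open>Every summand is nonnegative, so all vanish; by
    \<open>pos_semidef_kernel\<close> both \<open>B\<close> and \<open>C\<close>, and therefore
    \<open>D\<close>, annihilate the columns of \<open>D\<close>.\<close>
  have DD: "(D * D) $$ (i, j) = 0" if ij: "i < n" "j < n" for i j
  proof -
    have c: "col D j \<in> carrier_vec n" using D by auto
    have "(B *\<^sub>v col D j) \<bullet>c col D j + (C *\<^sub>v col D j) \<bullet>c col D j = 0"
      using sum0 pos ij by (subst (asm) sum_nonneg_eq_0_iff) auto
    then have "(B *\<^sub>v col D j) \<bullet>c col D j = 0" "(C *\<^sub>v col D j) \<bullet>c col D j = 0"
      using pos[OF ij(2)] by (simp_all add: add_nonneg_eq_0_iff)
    then have "B *\<^sub>v col D j = 0\<^sub>v n" "C *\<^sub>v col D j = 0\<^sub>v n"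
      using pos_semidef_kernel[OF B c] pos_semidef_kernel[OF C c] by auto
    then have "D *\<^sub>v col D j = 0\<^sub>v n"
      unfolding D_def[THEN arg_cong, of "\<lambda>M. M *\<^sub>v _"]
      using minus_mult_distrib_mat_vec[OF Bc Cc c] by simp
    then have "(D *\<^sub>v col D j) $ i = 0" using ij by simp
    then show ?thesis using ij D by simp
  qed
  have "mat_trace (D * D) = 0"
    using DD D by (auto simp: mat_trace_def simp del: index_mult_mat(1))
  then have "frobenius_sq D = 0" unfolding frobenius_sq_hermitian[OF D Dh] by simp
  then have D0: "D $$ (i, j) = 0" if "i < n" "j < n" for i j
    using frobenius_sq_eq_0[of D i j] D that by auto
  show ?thesis
  proof (rule eq_matI)
    fix i j assume "i < dim_row C" "j < dim_col C"
    then show "B $$ (i, j) = C $$ (i, j)"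
      using D0[of i j] Bc Cc by (auto simp: D_def)
  qed (use Bc Cc in auto)
qed

text \<open>The trace norm is the trace of the root \<open>B\<close> of \<open>A * A\<close>.
  Cauchy-Schwarz on the \<open>n\<close> diagonal entries bounds its square by \<open>n\<close>
  times the squared Frobenius norm of \<open>B\<close>, which agrees with that of \<open>A\<close>
  because \<open>B * B = A * A\<close>.\<close>

lemma trace_norm_hermitian_le:
  assumes A: "A \<in> carrier_mat n n" and herm: "mat_adjoint A = A"
  shows "(trace_norm A)\<^sup>2 \<le> real n * frobenius_sq A"
proof -
  obtain B where B: "pos_semidef n B" and BB: "B * B = A * A"
    using ex_pos_semidef_root_of_square[OF A herm] by blast
  have Bc: "B \<in> carrier_mat n n" and Bh: "mat_adjoint B = B" using B by (auto simp: pos_semidef_def)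
  have "psd_sqrt (A * A) = B"
    unfolding psd_sqrt_def
  proof (rule the_equality)
    show "pos_semidef (dim_row (A * A)) B \<and> B * B = A * A" using A B BB by simp
    fix C assume "pos_semidef (dim_row (A * A)) C \<and> C * C = A * A"
    then show "C = B" using A B BB pos_semidef_root_unique[of n C B] by simp
  qed
  then have tn: "trace_norm A = (\<Sum>i<n. Re (B $$ (i, i)))"
    using Bc by (simp add: trace_norm_def herm mat_trace_def)
  have "complex_of_real (frobenius_sq B) = complex_of_real (frobenius_sq A)"
    unfolding frobenius_sq_hermitian[OF Bc Bh, symmetric] frobenius_sq_hermitian[OF A herm, symmetric] BB ..
  then have fro: "frobenius_sq B = frobenius_sq A" by simp
  have "(\<Sum>i<n. Re (B $$ (i, i)))\<^sup>2 \<le> (\<Sum>i<n. (Re (B $$ (i, i)))\<^sup>2) * real n"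
    using sum_squared_le_sum_of_squares[of "\<lambda>i. Re (B $$ (i, i))" "{..<n}"] by simp
  also have "(\<Sum>i<n. (Re (B $$ (i, i)))\<^sup>2) \<le> (\<Sum>i<n. \<Sum>j<n. (cmod (B $$ (i, j)))\<^sup>2)"
  proof (intro sum_mono)
    fix i assume "i \<in> {..<n}"
    have "(Re (B $$ (i, i)))\<^sup>2 \<le> (cmod (B $$ (i, i)))\<^sup>2"
      by (rule abs_le_square_iff[THEN iffD1]) (simp add: abs_Re_le_cmod)
    also have "\<dots> \<le> (\<Sum>j<n. (cmod (B $$ (i, j)))\<^sup>2)"
      using \<open>i \<in> {..<n}\<close> by (intro member_le_sum) auto
    finally show "(Re (B $$ (i, i)))\<^sup>2 \<le> (\<Sum>j<n. (cmod (B $$ (i, j)))\<^sup>2)" .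
  qed
  also have "\<dots> = frobenius_sq B" using Bc by (auto simp: frobenius_sq_def)
  finally show ?thesis unfolding tn fro by (simp add: mult_right_mono mult.commute)
qed

section \<open>Tensor products\<close>

lemma sum_div_mod:
  fixes f :: "nat \<Rightarrow> nat \<Rightarrow> 'a :: comm_monoid_add"
  shows "(\<Sum>k<a * b. f (k div b) (k mod b)) = (\<Sum>i<a. \<Sum>j<b. f i j)"
proof -
  have "(\<Sum>i<a. \<Sum>j<b. f i j) = (\<Sum>(i, j)\<in>{..<a} \<times> {..<b}. f i j)"
    by (rule sum.cartesian_product)
  also have "\<dots> = (\<Sum>k<a * b. f (k div b) (k mod b))"
  proof (rule sum.reindex_bij_witness[where i = "\<lambda>k. (k div b, k mod b)" and j = "\<lambda>(i, j). i * b + j"])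
    fix p assume "p \<in> {..<a} \<times> {..<b}"
    then obtain i j where p: "p = (i, j)" "i < a" "j < b" by auto
    have "i * b + j < Suc i * b" using p by simp
    also have "\<dots> \<le> a * b" using p by (intro mult_le_mono1) auto
    finally show "(case p of (i, j) \<Rightarrow> i * b + j) \<in> {..<a * b}" using p by simp
  next
    fix k assume "k \<in> {..<a * b}"
    then show "(k div b, k mod b) \<in> {..<a} \<times> {..<b}"
      by (cases "b = 0") (auto simp: less_mult_imp_div_less)
  qed auto
  finally show ?thesis ..
qed

lemma tensor_mat_dim [simp]:
  "dim_row (tensor_mat A B) = dim_row A * dim_row B"
  "dim_col (tensor_mat A B) = dim_col A * dim_col B"
  by (simp_all add: tensor_mat_def)

lemma tensor_mat_carrier:
  "A \<in> carrier_mat a b \<Longrightarrow> B \<in> carrier_mat c d \<Longrightarrow> tensor_mat A B \<in> carrier_mat (a * c) (b * d)"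
  by (intro carrier_matI) auto

lemma tensor_mat_index:
  "i < dim_row A * dim_row B \<Longrightarrow> j < dim_col A * dim_col B \<Longrightarrow>
   tensor_mat A B $$ (i, j) =
     A $$ (i div dim_row B, j div dim_col B) * B $$ (i mod dim_row B, j mod dim_col B)"
  by (simp add: tensor_mat_def)

text \<open>Splitting both summation indices into quotient and remainder separates the factors. Its
  iterated form yields the product form of outcome probabilities as well as the norm of the dual
  tensors.\<close>

lemma mat_trace_tensor_mat_mult:
  assumes "A \<in> carrier_mat a a" "B \<in> carrier_mat b b" "C \<in> carrier_mat a a" "D \<in> carrier_mat b b"
  shows "mat_trace (tensor_mat A B * tensor_mat C D) = mat_trace (A * C) * mat_trace (B * D)"
proof -
  have d: "dim_row A = a" "dim_col A = a" "dim_row B = b" "dim_col B = b"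
    "dim_row C = a" "dim_col C = a" "dim_row D = b" "dim_col D = b"
    using assms by auto
  have "mat_trace (tensor_mat A B * tensor_mat C D) =
      (\<Sum>i<a * b. \<Sum>j<a * b.
        (A $$ (i div b, j div b) * B $$ (i mod b, j mod b)) * (C $$ (j div b, i div b) * D $$ (j mod b, i mod b)))"
    unfolding mat_trace_mult[OF tensor_mat_carrier[OF assms(1,2)] tensor_mat_carrier[OF assms(3,4)]]
    by (intro sum.cong refl) (auto simp: tensor_mat_index d)
  also have "\<dots> = (\<Sum>i<a. \<Sum>k<b. \<Sum>j<a. \<Sum>l<b.
      (A $$ (i, j) * B $$ (k, l)) * (C $$ (j, i) * D $$ (l, k)))"
    by (simp only: sum_div_mod[of "\<lambda>i k. \<Sum>j<a. \<Sum>l<b. (A $$ (i, j) * B $$ (k, l)) * (C $$ (j, i) * D $$ (l, k))"]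
       sum_div_mod[of "\<lambda>j l. (A $$ (_, j) * B $$ (_, l)) * (C $$ (j, _) * D $$ (l, _))"])
  also have "\<dots> = (\<Sum>i<a. \<Sum>k<b. (\<Sum>j<a. A $$ (i, j) * C $$ (j, i)) * (\<Sum>l<b. B $$ (k, l) * D $$ (l, k)))"
    unfolding sum_product by (intro sum.cong refl) (simp add: mult_ac)
  also have "\<dots> = mat_trace (A * C) * mat_trace (B * D)"
    unfolding mat_trace_mult[OF assms(1,3)] mat_trace_mult[OF assms(2,4)] sum_product ..
  finally show ?thesis .
qed

lemma tensor_list_simps:
  "tensor_list [] = 1\<^sub>m 1" "tensor_list (A # As) = tensor_mat A (tensor_list As)"
  by (simp_all add: tensor_list_def)

lemma tensor_list_carrier:
  "(\<And>A. A \<in> set As \<Longrightarrow> A \<in> carrier_mat d d) \<Longrightarrow>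
   tensor_list As \<in> carrier_mat (d ^ length As) (d ^ length As)"
  by (induction As) (auto simp: tensor_list_simps intro!: tensor_mat_carrier)

lemma tensor_list_map_carrier:
  "(\<And>x. x \<in> set xs \<Longrightarrow> f x \<in> carrier_mat d d) \<Longrightarrow>
   tensor_list (map f xs) \<in> carrier_mat (d ^ length xs) (d ^ length xs)"
  using tensor_list_carrier[of "map f xs" d] by auto

lemma mat_trace_tensor_list_mult:
  assumes "\<And>x. x \<in> set xs \<Longrightarrow> f x \<in> carrier_mat d d" "\<And>x. x \<in> set xs \<Longrightarrow> g x \<in> carrier_mat d d"
  shows "mat_trace (tensor_list (map f xs) * tensor_list (map g xs)) = (\<Prod>x\<leftarrow>xs. mat_trace (f x * g x))"
  using assms
proof (induction xs)
  case Nil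
  show ?case by (simp add: tensor_list_simps mat_trace_def)
next
  case (Cons x xs)
  then show ?case
    using mat_trace_tensor_mat_mult[of "f x" d "tensor_list (map f xs)" "d ^ length xs" "g x" "tensor_list (map g xs)"]
    by (simp add: tensor_list_simps tensor_list_map_carrier)
qed

lemma prod_list_upt: "(\<Prod>x\<leftarrow>[0..<n]. f x) = (\<Prod>x<n. f x)"
  using prod.distinct_set_conv_list[of "[0..<n]" f] by (simp add: lessThan_atLeast0)

text \<open>Digit \<open>0\<close> is the most significant one, in accordance with \<^const>\<open>tensor_mat\<close>.\<close>

definition qdigit :: "nat \<Rightarrow> nat \<Rightarrow> nat \<Rightarrow> nat" where
  "qdigit m a j = a div 2 ^ (m - Suc j) mod 2"

lemma qdigit_less_2 [simp]: "qdigit m a j < 2"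
  by (simp add: qdigit_def)

lemma qdigit_Suc_0: "a < 2 ^ Suc m \<Longrightarrow> qdigit (Suc m) a 0 = a div 2 ^ m"
  by (simp add: qdigit_def less_mult_imp_div_less)

text \<open>The bit in question has position \<open>m - Suc j\<close>, below \<open>m\<close>, so
  reduction modulo \<open>2 ^ m\<close> leaves it alone.\<close>

lemma qdigit_Suc_Suc:
  assumes "j < m"
  shows "qdigit (Suc m) a (Suc j) = qdigit m (a mod 2 ^ m) j"
proof -
  have "odd (a mod 2 ^ m div 2 ^ (m - Suc j)) = odd (a div 2 ^ (m - Suc j))"
    using bit_take_bit_iff[of m a "m - Suc j"] assms by (simp add: bit_iff_odd take_bit_eq_mod)
  then show ?thesis by (simp add: qdigit_def mod_2_eq_odd)
qed

text \<open>Needed to turn a product of Kronecker deltas in the digits into one Kronecker delta in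
  the indices.\<close>

lemma qdigit_inj:
  assumes "a < 2 ^ m" "b < 2 ^ m" "\<And>j. j < m \<Longrightarrow> qdigit m a j = qdigit m b j"
  shows "a = b"
  using assms
proof (induction m arbitrary: a b)
  case 0
  then show ?case by simp
next
  case (Suc m)
  have "a mod 2 ^ m = b mod 2 ^ m"
  proof (rule Suc.IH)
    fix j assume "j < m"
    then show "qdigit m (a mod 2 ^ m) j = qdigit m (b mod 2 ^ m) j"
      using Suc.prems(3)[of "Suc j"] by (simp add: qdigit_Suc_Suc)
  qed simp_all
  moreover have "a div 2 ^ m = b div 2 ^ m"
    using Suc.prems(3)[of 0] Suc.prems(1,2) by (simp add: qdigit_Suc_0)
  ultimately show ?case by (metis div_mult_mod_eq)
qed

text \<open>In this form, a sum over all outcome tuples of products of tensor entries factors into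
  one sum per qubit.\<close>

lemma tensor_list_index:
  assumes "\<And>A. A \<in> set As \<Longrightarrow> A \<in> carrier_mat 2 2" "a < 2 ^ length As" "b < 2 ^ length As"
  shows "tensor_list As $$ (a, b) =
    (\<Prod>j<length As. As ! j $$ (qdigit (length As) a j, qdigit (length As) b j))"
  using assms
proof (induction As arbitrary: a b)
  case Nil
  then show ?case by (simp add: tensor_list_simps)
next
  case (Cons A As)
  let ?m = "length As"
  have A: "dim_row A = 2" "dim_col A = 2" using Cons.prems(1)[of A] by auto
  have T: "dim_row (tensor_list As) = 2 ^ ?m" "dim_col (tensor_list As) = 2 ^ ?m"
    using tensor_list_carrier[of As 2] Cons.prems(1) by auto
  have "tensor_list (A # As) $$ (a, b) =
      A $$ (a div 2 ^ ?m, b div 2 ^ ?m) * tensor_list As $$ (a mod 2 ^ ?m, b mod 2 ^ ?m)"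
    unfolding tensor_list_simps using Cons.prems(2,3) by (subst tensor_mat_index) (simp_all add: A T)
  also have "\<dots> = (\<Prod>j<length (A # As). (A # As) ! j $$
      (qdigit (length (A # As)) a j, qdigit (length (A # As)) b j))"
    using Cons.prems
    by (simp add: Cons.IH prod.lessThan_Suc_shift qdigit_Suc_0 qdigit_Suc_Suc del: prod.lessThan_Suc)
  finally show ?case .
qed

lemma tensor_list_map_index:
  assumes "\<And>j. j < m \<Longrightarrow> f j \<in> carrier_mat 2 2" "a < 2 ^ m" "b < 2 ^ m"
  shows "tensor_list (map f [0..<m]) $$ (a, b) = (\<Prod>j<m. f j $$ (qdigit m a j, qdigit m b j))"
  using assms by (subst tensor_list_index) auto

section \<open>Means of independent samples\<close>

text \<open>Expanding the square gives terms indexed by pairs of samples. A pair of distinct samples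
  contributes the factor mean zero; an equal pair contributes the second moment, the other samples
  summing to one.\<close>

lemma product_weight_variance:
  fixes q :: "'a \<Rightarrow> real" and g :: "'a \<Rightarrow> complex"
  assumes U: "finite U" and q1: "(\<Sum>u\<in>U. q u) = 1" and mean0: "(\<Sum>u\<in>U. of_real (q u) * g u) = 0"
  shows "(\<Sum>w\<in>{..<n} \<rightarrow>\<^sub>E U. (\<Prod>i<n. q (w i)) * (cmod (\<Sum>i<n. g (w i)))\<^sup>2) =
    real n * (\<Sum>u\<in>U. q u * (cmod (g u))\<^sup>2)"
proof -
  \<comment> \<open>Writes the weight times \<open>g (w i) * cnj (g (w k))\<close> as a single
    product over all positions \<open>l\<close>, so that the sum over \<open>w\<close> can be
    exchanged with the product.\<close>
  define h where "h i k l u = complex_of_real (q u) * (if l = i then g u else 1) * (if l = k then cnj (g u) else 1)"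
    for i k l :: nat and u
  define V where "V = (\<Sum>u\<in>U. q u * (cmod (g u))\<^sup>2)"
  have cross: "(\<Sum>w\<in>{..<n} \<rightarrow>\<^sub>E U. \<Prod>l<n. h i k l (w l)) = (if i = k then of_real V else 0)"
    if ik: "i < n" "k < n" for i k
  proof -
    have "(\<Sum>w\<in>{..<n} \<rightarrow>\<^sub>E U. \<Prod>l<n. h i k l (w l)) = (\<Prod>l<n. \<Sum>u\<in>U. h i k l u)"
      using U by (intro prod_sum_PiE[symmetric]) auto
    also have "\<dots> = (if i = k then of_real V else 0)"
    proof (cases "i = k")
      case True
      have "(\<Sum>u\<in>U. h i k l u) = (if l = i then of_real V else 1)" for l
      proof (cases "l = i")
        case True
        have "h i k l u = complex_of_real (q u * (cmod (g u))\<^sup>2)" for u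
          unfolding of_real_mult complex_norm_square using True \<open>i = k\<close> by (simp add: h_def)
        then show ?thesis using True by (simp add: V_def)
      next
        case False
        then have "(\<Sum>u\<in>U. h i k l u) = of_real (\<Sum>u\<in>U. q u)"
          using \<open>i = k\<close> by (simp add: h_def)
        then show ?thesis using q1 False by simp
      qed
      then show ?thesis using True ik by simp
    next
      case False
      then have "(\<Sum>u\<in>U. h i k i u) = 0" using mean0 by (simp add: h_def)
      then show ?thesis using False ik by (auto intro!: prod_zero)
    qed
    finally show ?thesis .
  qed
  have expand: "complex_of_real ((\<Prod>i<n. q (w i)) * (cmod (\<Sum>i<n. g (w i)))\<^sup>2) =
      (\<Sum>i<n. \<Sum>k<n. \<Prod>l<n. h i k l (w l))" for w
  proof -
    have "(\<Prod>l<n. h i k l (w l)) = of_real (\<Prod>l<n. q (w l)) * (g (w i) * cnj (g (w k)))"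
      if "i < n" "k < n" for i k
      unfolding h_def prod.distrib using that by (simp add: mult_ac)
    then have "(\<Sum>i<n. \<Sum>k<n. \<Prod>l<n. h i k l (w l)) =
        (\<Sum>i<n. \<Sum>k<n. of_real (\<Prod>l<n. q (w l)) * (g (w i) * cnj (g (w k))))"
      by (intro sum.cong refl) auto
    also have "\<dots> = of_real (\<Prod>l<n. q (w l)) * (\<Sum>i<n. \<Sum>k<n. g (w i) * cnj (g (w k)))"
      unfolding sum_distrib_left ..
    also have "\<dots> = of_real (\<Prod>l<n. q (w l)) * ((\<Sum>i<n. g (w i)) * cnj (\<Sum>i<n. g (w i)))"
      unfolding sum_product cnj_sum ..
    finally show ?thesis unfolding of_real_mult complex_norm_square ..
  qed
  have "complex_of_real (\<Sum>w\<in>{..<n} \<rightarrow>\<^sub>E U. (\<Prod>i<n. q (w i)) * (cmod (\<Sum>i<n. g (w i)))\<^sup>2) =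
      (\<Sum>w\<in>{..<n} \<rightarrow>\<^sub>E U. \<Sum>i<n. \<Sum>k<n. \<Prod>l<n. h i k l (w l))"
    unfolding of_real_sum expand ..
  also have "\<dots> = (\<Sum>i<n. \<Sum>k<n. \<Sum>w\<in>{..<n} \<rightarrow>\<^sub>E U. \<Prod>l<n. h i k l (w l))"
    by (subst sum.swap, intro sum.cong refl, rule sum.swap)
  also have "\<dots> = (\<Sum>i<n. \<Sum>k<n. if i = k then of_real V else 0)"
    by (intro sum.cong refl cross) auto
  also have "\<dots> = complex_of_real (real n * V)" by simp
  finally show ?thesis unfolding of_real_eq_iff V_def .
qed

text \<open>After centring, the variance equals the second moment minus the squared modulus of the
  mean; the latter is simply dropped.\<close>

lemma product_weight_mean_error:
  fixes q :: "'a \<Rightarrow> real" and f :: "'a \<Rightarrow> complex"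
  assumes U: "finite U" and q1: "(\<Sum>u\<in>U. q u) = 1" and mean: "(\<Sum>u\<in>U. of_real (q u) * f u) = \<mu>"
    and n: "n > 0"
  shows "(\<Sum>w\<in>{..<n} \<rightarrow>\<^sub>E U. (\<Prod>i<n. q (w i)) * (cmod ((\<Sum>i<n. f (w i)) / of_nat n - \<mu>))\<^sup>2)
    \<le> (\<Sum>u\<in>U. q u * (cmod (f u))\<^sup>2) / real n"
proof -
  define g where "g u = f u - \<mu>" for u
  have q1': "(\<Sum>u\<in>U. complex_of_real (q u)) = 1"
    using q1 by (metis of_real_1 of_real_sum)
  have g0: "(\<Sum>u\<in>U. of_real (q u) * g u) = 0"
    using mean q1' by (simp add: g_def right_diff_distrib sum_subtractf flip: sum_distrib_right)
  have *: "(cmod ((\<Sum>i<n. f (w i)) / of_nat n - \<mu>))\<^sup>2 = (cmod (\<Sum>i<n. g (w i)))\<^sup>2 / (real n)\<^sup>2" for w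
  proof -
    have "(\<Sum>i<n. f (w i)) / of_nat n - \<mu> = (\<Sum>i<n. g (w i)) / of_nat n"
      using n by (simp add: g_def sum_subtractf field_simps)
    then show ?thesis by (simp add: norm_divide power_divide)
  qed
  have "complex_of_real (\<Sum>u\<in>U. q u * (cmod (g u))\<^sup>2) =
      (\<Sum>u\<in>U. of_real (q u) * (f u * cnj (f u))) - (\<Sum>u\<in>U. of_real (q u) * f u) * cnj \<mu>
      - \<mu> * cnj (\<Sum>u\<in>U. of_real (q u) * f u) + \<mu> * cnj \<mu> * (\<Sum>u\<in>U. complex_of_real (q u))"
    unfolding of_real_sum of_real_mult complex_norm_square cnj_sum sum_distrib_left sum_distrib_right
      sum_subtractf[symmetric] sum.distrib[symmetric]
    by (intro sum.cong refl) (simp add: g_def algebra_simps)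
  also have "\<dots> = complex_of_real ((\<Sum>u\<in>U. q u * (cmod (f u))\<^sup>2) - (cmod \<mu>)\<^sup>2)"
    unfolding mean q1' of_real_diff of_real_sum of_real_mult complex_norm_square by simp
  finally have V: "(\<Sum>u\<in>U. q u * (cmod (g u))\<^sup>2) \<le> (\<Sum>u\<in>U. q u * (cmod (f u))\<^sup>2)"
    unfolding of_real_eq_iff by simp
  have "(\<Sum>w\<in>{..<n} \<rightarrow>\<^sub>E U. (\<Prod>i<n. q (w i)) * (cmod ((\<Sum>i<n. f (w i)) / of_nat n - \<mu>))\<^sup>2) =
      real n * (\<Sum>u\<in>U. q u * (cmod (g u))\<^sup>2) / (real n)\<^sup>2"
    unfolding * product_weight_variance[OF U q1 g0, symmetric] by (simp add: sum_divide_distrib)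
  also have "\<dots> = (\<Sum>u\<in>U. q u * (cmod (g u))\<^sup>2) / real n"
    using n by (simp add: power2_eq_square)
  finally show ?thesis using V by (simp add: divide_right_mono)
qed

section \<open>The Pauli measurement\<close>

text \<open>The form at \<open>x\<close> is \<open>c\<close> times a squared modulus of an inner
  product.\<close>

lemma pos_semidef_rank_one:
  assumes "0 \<le> c"
  shows "pos_semidef n (mat n n (\<lambda>(a, b). of_real c * v a * cnj (v b)))" (is "pos_semidef n ?A")
  unfolding pos_semidef_def
proof (intro conjI ballI)
  show "mat_adjoint ?A = ?A" by (rule eq_matI) auto
  fix x :: "complex vec" assume x: "x \<in> carrier_vec n"
  have "(?A *\<^sub>v x) \<bullet>c x = (\<Sum>i<n. \<Sum>j<n. ?A $$ (i, j) * x $ j * cnj (x $ i))"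
    using x by (intro sesquilinear_sum) auto
  also have "\<dots> = of_real c * (\<Sum>i<n. \<Sum>j<n. v i * cnj (x $ i) * cnj (v j * cnj (x $ j)))"
    unfolding sum_distrib_left by (intro sum.cong refl) (simp add: mult_ac)
  also have "\<dots> = of_real c * ((\<Sum>i<n. v i * cnj (x $ i)) * cnj (\<Sum>i<n. v i * cnj (x $ i)))"
    unfolding cnj_sum sum_product ..
  also have "\<dots> = of_real (c * (cmod (\<Sum>i<n. v i * cnj (x $ i)))\<^sup>2)"
    unfolding of_real_mult complex_norm_square ..
  finally show "0 \<le> (?A *\<^sub>v x) \<bullet>c x" using assms by (simp add: less_eq_complex_def)
qed auto

text \<open>Eigenvectors of Z, X and Y in pairs, left unnormalised to avoid square roots of
  2.\<close>

definition pauli_vec :: "nat \<Rightarrow> nat \<Rightarrow> complex" where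
  "pauli_vec k a = [[1, 0], [0, 1], [1, 1], [1, -1], [1, \<i>], [1, -\<i>]] ! k ! a"

text \<open>The vectors of index at least 2 have squared length 2, so their weight is half of
  1/3.\<close>

definition pauli_weight :: "nat \<Rightarrow> real" where
  "pauli_weight k = (if k < 2 then 1 / 3 else 1 / 6)"

definition pauli_effect :: "nat \<Rightarrow> complex mat" where
  "pauli_effect k = mat 2 2 (\<lambda>(a, b). of_real (pauli_weight k) * pauli_vec k a * cnj (pauli_vec k b))"

text \<open>For a unit vector \<open>\<phi>\<close> and the effect \<open>F = \<bar>\<phi>\<rangle>\<langle>\<phi>\<bar> / 3\<close> this is \<open>3 \<bar>\<phi>\<rangle>\<langle>\<phi>\<bar> - 1 = 9 F - 1\<close>.\<close>

definition pauli_dual :: "nat \<Rightarrow> complex mat" where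
  "pauli_dual k = mat 2 2 (\<lambda>(a, b). 9 * pauli_effect k $$ (a, b) - of_bool (a = b))"

lemma pauli_carrier [simp]: "pauli_effect k \<in> carrier_mat 2 2" "pauli_dual k \<in> carrier_mat 2 2"
  by (simp_all add: pauli_effect_def pauli_dual_def)

lemma sum_pauli_effect:
  assumes "a < 2" "b < 2"
  shows "(\<Sum>k<6. pauli_effect k $$ (a, b)) = of_bool (a = b)"
  using less_2_cases[OF assms(1)] less_2_cases[OF assms(2)]
  by (elim disjE) (simp_all add: pauli_effect_def pauli_vec_def pauli_weight_def eval_nat_numeral complex_eq_iff)

text \<open>The right-hand side is the swap operator in coordinates. With Pi_k the eigenprojections,
  the sum of Pi_k tensor Pi_k is identity plus swap and the sum of Pi_k is 3; for F_k = Pi_k / 3 and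
  D_k = 3 Pi_k - 1 the identity part cancels.\<close>

lemma pauli_reconstruction:
  assumes "a < 2" "b < 2" "c < 2" "d < 2"
  shows "(\<Sum>k<6. pauli_effect k $$ (a, b) * pauli_dual k $$ (c, d)) = of_bool (a = d \<and> b = c)"
  using assms[THEN less_2_cases]
  by (elim disjE) (simp_all add: pauli_effect_def pauli_dual_def pauli_vec_def pauli_weight_def eval_nat_numeral complex_eq_iff)

lemma pauli_dual_adjoint: "mat_adjoint (pauli_dual k) = pauli_dual k"
  by (rule eq_matI) (auto simp: pauli_dual_def pauli_effect_def)

text \<open>The eigenvalues of the dual are 2 and -1, whence 4 + 1.\<close>

lemma mat_trace_pauli_dual_square:
  assumes "k < 6"
  shows "mat_trace (pauli_dual k * pauli_dual k) = 5"
proof -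
  have "k = 0 \<or> k = 1 \<or> k = 2 \<or> k = 3 \<or> k = 4 \<or> k = 5" using assms by auto
  then show ?thesis
    unfolding mat_trace_mult[OF pauli_carrier(2) pauli_carrier(2)]
    by (elim disjE) (simp_all add: pauli_effect_def pauli_dual_def pauli_vec_def pauli_weight_def eval_nat_numeral complex_eq_iff)
qed

lemma povm_pauli: "povm 2 (map pauli_effect [0..<6])"
  unfolding povm_def
proof (intro conjI ballI)
  fix F assume "F \<in> set (map pauli_effect [0..<6])"
  then obtain k where "F = pauli_effect k" by auto
  then show "pos_semidef 2 F"
    unfolding pauli_effect_def using pos_semidef_rank_one[of "pauli_weight k" 2 "pauli_vec k"]
    by (simp add: pauli_weight_def)
next
  have up: "[0..<6] = [0, 1, 2, 3, 4, 5]" by (simp add: upt_rec)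
  show "foldr (+) (map pauli_effect [0..<6]) (0\<^sub>m 2 2) = 1\<^sub>m 2"
    unfolding up
  proof (rule eq_matI)
    fix a b :: nat assume "a < dim_row (1\<^sub>m 2)" "b < dim_col (1\<^sub>m 2)"
    then have ab: "a < 2" "b < 2" by auto
    have d: "dim_row (pauli_effect k) = 2" "dim_col (pauli_effect k) = 2" for k
      by (simp_all add: pauli_effect_def)
    have "foldr (+) (map pauli_effect [0, 1, 2, 3, 4, 5]) (0\<^sub>m 2 2) $$ (a, b) = (\<Sum>k<6. pauli_effect k $$ (a, b))"
      using ab by (simp add: d eval_nat_numeral)
    then show "foldr (+) (map pauli_effect [0, 1, 2, 3, 4, 5]) (0\<^sub>m 2 2) $$ (a, b) = 1\<^sub>m 2 $$ (a, b)"
      using sum_pauli_effect[OF ab] ab by simp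
  qed (simp_all add: pauli_effect_def)
qed

section \<open>The Pauli measurement on all qubits of one copy\<close>

definition pauli_outcomes :: "nat \<Rightarrow> (nat \<Rightarrow> nat) set" where
  "pauli_outcomes m = {..<m} \<rightarrow>\<^sub>E {..<6}"

definition pauli_effects :: "nat \<Rightarrow> (nat \<Rightarrow> nat) \<Rightarrow> complex mat" where
  "pauli_effects m u = tensor_list (map (\<lambda>j. pauli_effect (u j)) [0..<m])"

definition pauli_duals :: "nat \<Rightarrow> (nat \<Rightarrow> nat) \<Rightarrow> complex mat" where
  "pauli_duals m u = tensor_list (map (\<lambda>j. pauli_dual (u j)) [0..<m])"

lemma finite_pauli_outcomes [simp]: "finite (pauli_outcomes m)"
  unfolding pauli_outcomes_def by (rule finite_PiE) auto

lemma pauli_effects_carrier: "pauli_effects m u \<in> carrier_mat (2 ^ m) (2 ^ m)"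
  unfolding pauli_effects_def using tensor_list_map_carrier[of "[0..<m]"] by simp

lemma pauli_duals_carrier: "pauli_duals m u \<in> carrier_mat (2 ^ m) (2 ^ m)"
  unfolding pauli_duals_def using tensor_list_map_carrier[of "[0..<m]"] by simp

lemma pauli_effects_index:
  "a < 2 ^ m \<Longrightarrow> b < 2 ^ m \<Longrightarrow>
   pauli_effects m u $$ (a, b) = (\<Prod>j<m. pauli_effect (u j) $$ (qdigit m a j, qdigit m b j))"
  unfolding pauli_effects_def by (rule tensor_list_map_index) auto

lemma pauli_duals_index:
  "a < 2 ^ m \<Longrightarrow> b < 2 ^ m \<Longrightarrow>
   pauli_duals m u $$ (a, b) = (\<Prod>j<m. pauli_dual (u j) $$ (qdigit m a j, qdigit m b j))"
  unfolding pauli_duals_def by (rule tensor_list_map_index) auto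

lemma prod_of_bool: "finite A \<Longrightarrow> (\<Prod>j\<in>A. of_bool (P j)) = (of_bool (\<forall>j\<in>A. P j) :: complex)"
  by (induction A rule: finite_induct) auto

lemma qdigit_eq_iff:
  "a < 2 ^ m \<Longrightarrow> b < 2 ^ m \<Longrightarrow> (\<forall>j\<in>{..<m}. qdigit m a j = qdigit m b j) \<longleftrightarrow> a = b"
  using qdigit_inj by auto

lemma sum_pauli_effects:
  assumes "a < 2 ^ m" "b < 2 ^ m"
  shows "(\<Sum>u\<in>pauli_outcomes m. pauli_effects m u $$ (a, b)) = of_bool (a = b)"
proof -
  have "(\<Sum>u\<in>pauli_outcomes m. pauli_effects m u $$ (a, b)) =
      (\<Prod>j<m. \<Sum>k<6. pauli_effect k $$ (qdigit m a j, qdigit m b j))"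
    unfolding pauli_outcomes_def pauli_effects_index[OF assms]
    by (rule prod_sum_PiE[symmetric]) auto
  then show ?thesis
    using assms by (simp add: sum_pauli_effect prod_of_bool qdigit_eq_iff del: lessThan_iff)
qed

text \<open>The sum over outcome tuples factors into one-qubit swap identities, whose product is the
  swap of two registers of \<open>m\<close> qubits.\<close>

lemma pauli_reconstruction_tensor:
  assumes "a < 2 ^ m" "b < 2 ^ m" "c < 2 ^ m" "d < 2 ^ m"
  shows "(\<Sum>u\<in>pauli_outcomes m. pauli_effects m u $$ (a, b) * pauli_duals m u $$ (c, d)) =
    of_bool (a = d \<and> b = c)"
proof -
  have "(\<Sum>u\<in>pauli_outcomes m. pauli_effects m u $$ (a, b) * pauli_duals m u $$ (c, d)) =
      (\<Prod>j<m. \<Sum>k<6. pauli_effect k $$ (qdigit m a j, qdigit m b j) *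
         pauli_dual k $$ (qdigit m c j, qdigit m d j))"
    unfolding pauli_outcomes_def pauli_effects_index[OF assms(1,2)] pauli_duals_index[OF assms(3,4)]
      prod.distrib[symmetric]
    by (rule prod_sum_PiE[symmetric]) auto
  also have "\<dots> = of_bool (a = d \<and> b = c)"
    using qdigit_eq_iff[OF assms(1,4)] qdigit_eq_iff[OF assms(2,3)]
    by (simp add: pauli_reconstruction prod_of_bool ball_conj_distrib del: lessThan_iff)
  finally show ?thesis .
qed

text \<open>Kept complex so that the linear identities hold for every matrix of the right size; for
  states, nonnegativity in the complex order also gives reality.\<close>

definition pauli_prob :: "nat \<Rightarrow> complex mat \<Rightarrow> (nat \<Rightarrow> nat) \<Rightarrow> complex" where
  "pauli_prob m \<rho> u = mat_trace (pauli_effects m u * \<rho>)"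

lemma pauli_prob_sum:
  "\<rho> \<in> carrier_mat (2 ^ m) (2 ^ m) \<Longrightarrow>
   pauli_prob m \<rho> u = (\<Sum>a<2 ^ m. \<Sum>b<2 ^ m. pauli_effects m u $$ (a, b) * \<rho> $$ (b, a))"
  unfolding pauli_prob_def by (rule mat_trace_mult[OF pauli_effects_carrier])

lemma sum_pauli_prob:
  assumes \<rho>: "\<rho> \<in> carrier_mat (2 ^ m) (2 ^ m)"
  shows "(\<Sum>u\<in>pauli_outcomes m. pauli_prob m \<rho> u) = mat_trace \<rho>"
proof -
  have "(\<Sum>u\<in>pauli_outcomes m. pauli_prob m \<rho> u) =
      (\<Sum>a<2 ^ m. \<Sum>b<2 ^ m. \<Sum>u\<in>pauli_outcomes m. pauli_effects m u $$ (a, b) * \<rho> $$ (b, a))"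
    unfolding pauli_prob_sum[OF \<rho>] by (subst sum.swap, intro sum.cong refl, rule sum.swap)
  also have "\<dots> = (\<Sum>a<2 ^ m. \<Sum>b<2 ^ m. if b = a then \<rho> $$ (a, a) else 0)"
    unfolding sum_distrib_right[symmetric]
    by (intro sum.cong refl) (auto simp: sum_pauli_effects)
  also have "\<dots> = mat_trace \<rho>" using \<rho> by (simp add: mat_trace_def)
  finally show ?thesis .
qed

text \<open>Unbiasedness of the estimate from one copy: the swap identity collapses the double sum
  of the trace to a single entry.\<close>

lemma sum_pauli_prob_dual:
  assumes \<rho>: "\<rho> \<in> carrier_mat (2 ^ m) (2 ^ m)" and cd: "c < 2 ^ m" "d < 2 ^ m"
  shows "(\<Sum>u\<in>pauli_outcomes m. pauli_prob m \<rho> u * pauli_duals m u $$ (c, d)) = \<rho> $$ (c, d)"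
proof -
  have "(\<Sum>u\<in>pauli_outcomes m. pauli_prob m \<rho> u * pauli_duals m u $$ (c, d)) =
      (\<Sum>u\<in>pauli_outcomes m. \<Sum>a<2 ^ m. \<Sum>b<2 ^ m.
        pauli_effects m u $$ (a, b) * pauli_duals m u $$ (c, d) * \<rho> $$ (b, a))"
    unfolding pauli_prob_sum[OF \<rho>] sum_distrib_right
    by (intro sum.cong refl) (simp add: mult_ac)
  also have "\<dots> = (\<Sum>a<2 ^ m. \<Sum>b<2 ^ m. \<Sum>u\<in>pauli_outcomes m.
        pauli_effects m u $$ (a, b) * pauli_duals m u $$ (c, d) * \<rho> $$ (b, a))"
    by (subst sum.swap, intro sum.cong refl, rule sum.swap)
  also have "\<dots> = (\<Sum>a<2 ^ m. \<Sum>b<2 ^ m. if a = d then if b = c then \<rho> $$ (c, d) else 0 else 0)"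
    unfolding sum_distrib_right[symmetric]
    by (intro sum.cong refl) (auto simp: pauli_reconstruction_tensor cd)
  also have "\<dots> = (\<Sum>a<2 ^ m. if a = d then \<rho> $$ (c, d) else 0)"
    using cd by (intro sum.cong refl) auto
  also have "\<dots> = \<rho> $$ (c, d)" using cd by simp
  finally show ?thesis .
qed

text \<open>A tensor product of rank-one effects is again rank one, namely \<open>W\<close> times
  the projector-like matrix of the product vector \<open>V\<close>; the probability is then
  \<open>W\<close> times the form of \<open>\<rho>\<close> at \<open>V\<close>.\<close>

lemma pauli_prob_nonneg:
  assumes \<rho>: "pos_semidef (2 ^ m) \<rho>"
  shows "0 \<le> pauli_prob m \<rho> u"
proof -
  have \<rho>c: "\<rho> \<in> carrier_mat (2 ^ m) (2 ^ m)" using \<rho> by (simp add: pos_semidef_def)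
  define W where "W = (\<Prod>j<m. pauli_weight (u j))"
  define V where "V = vec (2 ^ m) (\<lambda>a. \<Prod>j<m. pauli_vec (u j) (qdigit m a j))"
  have V: "V \<in> carrier_vec (2 ^ m)" by (simp add: V_def)
  have F: "pauli_effects m u $$ (a, b) = of_real W * V $ a * cnj (V $ b)"
    if "a < 2 ^ m" "b < 2 ^ m" for a b
    unfolding pauli_effects_index[OF that]
    using that by (simp add: pauli_effect_def W_def V_def prod.distrib)
  have "pauli_prob m \<rho> u = of_real W * (\<Sum>b<2 ^ m. \<Sum>a<2 ^ m. \<rho> $$ (b, a) * V $ a * cnj (V $ b))"
    unfolding pauli_prob_sum[OF \<rho>c] sum_distrib_left
    by (subst sum.swap, intro sum.cong refl) (simp add: F)
  also have "\<dots> = of_real W * ((\<rho> *\<^sub>v V) \<bullet>c V)"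
    unfolding sesquilinear_sum[OF \<rho>c V V] ..
  finally have "pauli_prob m \<rho> u = of_real W * ((\<rho> *\<^sub>v V) \<bullet>c V)" .
  moreover have "0 \<le> (\<rho> *\<^sub>v V) \<bullet>c V" using \<rho> V by (simp add: pos_semidef_def)
  moreover have "0 \<le> W" unfolding W_def by (intro prod_nonneg) (auto simp: pauli_weight_def)
  ultimately show ?thesis by (simp add: less_eq_complex_def)
qed

text \<open>Each qubit contributes the factor 5 whatever its outcome, so the second moment of the
  estimate does not depend on the state.\<close>

lemma frobenius_sq_pauli_duals:
  assumes u: "u \<in> pauli_outcomes m"
  shows "frobenius_sq (pauli_duals m u) = 5 ^ m"
proof -
  have u6: "u j < 6" if "j < m" for j using u that by (auto simp: pauli_outcomes_def)
  have "mat_adjoint (pauli_duals m u) = pauli_duals m u"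
  proof (rule eq_matI)
    fix a b assume "a < dim_row (pauli_duals m u)" "b < dim_col (pauli_duals m u)"
    then have ab: "a < 2 ^ m" "b < 2 ^ m" using pauli_duals_carrier[of m u] by auto
    have "mat_adjoint (pauli_duals m u) $$ (a, b) = cnj (pauli_duals m u $$ (b, a))"
      using ab pauli_duals_carrier[of m u] by (intro mat_adjoint_index) auto
    also have "\<dots> = pauli_duals m u $$ (a, b)"
      unfolding pauli_duals_index[OF ab] pauli_duals_index[OF ab(2,1)] cnj_prod
      using hermitian_index[OF pauli_carrier(2) pauli_dual_adjoint] u6 by (intro prod.cong refl) auto
    finally show "mat_adjoint (pauli_duals m u) $$ (a, b) = pauli_duals m u $$ (a, b)" .
  qed (use pauli_duals_carrier[of m u] in auto)
  then have "complex_of_real (frobenius_sq (pauli_duals m u)) = mat_trace (pauli_duals m u * pauli_duals m u)"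
    using frobenius_sq_hermitian[OF pauli_duals_carrier] by simp
  also have "\<dots> = (\<Prod>j<m. mat_trace (pauli_dual (u j) * pauli_dual (u j)))"
    unfolding pauli_duals_def prod_list_upt[symmetric] by (rule mat_trace_tensor_list_mult[of _ _ 2]) auto
  also have "\<dots> = complex_of_real (5 ^ m)" using u6 by (simp add: mat_trace_pauli_dual_square)
  finally show ?thesis unfolding of_real_eq_iff .
qed

section \<open>Linear inversion\<close>

text \<open>The projection onto the first basis vector; it guarantees that the choice in
  \<open>nearby_state\<close> has a candidate.\<close>

lemma ex_density_operator: "0 < d \<Longrightarrow> \<exists>\<rho>. density_operator d \<rho>"
proof -
  assume d: "0 < d"
  let ?v = "\<lambda>a::nat. of_bool (a = 0) :: complex"
  let ?A = "mat d d (\<lambda>(a, b). of_real 1 * ?v a * cnj (?v b))"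
  have "mat_trace ?A = (\<Sum>i<d. if i = 0 then 1 else 0)"
    unfolding mat_trace_def by (intro sum.cong) auto
  then have "mat_trace ?A = 1" using d by simp
  moreover have "pos_semidef d ?A" by (rule pos_semidef_rank_one) simp
  ultimately show ?thesis unfolding density_operator_def by blast
qed

text \<open>The implication makes the choice a state even if no state is within the required distance
  of \<open>X\<close>.\<close>

definition nearby_state :: "nat \<Rightarrow> real \<Rightarrow> complex mat \<Rightarrow> complex mat" where
  "nearby_state d r X = (SOME \<sigma>. density_operator d \<sigma> \<and>
     ((\<exists>\<tau>. density_operator d \<tau> \<and> frobenius_sq (\<tau> - X) \<le> r) \<longrightarrow> frobenius_sq (\<sigma> - X) \<le> r))"

lemma nearby_state:
  assumes "0 < d"
  shows "density_operator d (nearby_state d r X)"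
    and "density_operator d \<tau> \<Longrightarrow> frobenius_sq (\<tau> - X) \<le> r \<Longrightarrow> frobenius_sq (nearby_state d r X - X) \<le> r"
proof -
  have "\<exists>\<sigma>. density_operator d \<sigma> \<and>
     ((\<exists>\<tau>. density_operator d \<tau> \<and> frobenius_sq (\<tau> - X) \<le> r) \<longrightarrow> frobenius_sq (\<sigma> - X) \<le> r)"
    using ex_density_operator[OF assms] by blast
  from someI_ex[OF this]
  show "density_operator d (nearby_state d r X)"
    and "density_operator d \<tau> \<Longrightarrow> frobenius_sq (\<tau> - X) \<le> r \<Longrightarrow> frobenius_sq (nearby_state d r X - X) \<le> r"
    unfolding nearby_state_def by blast+
qed

lemma frobenius_sq_minus_commute:
  assumes "A \<in> carrier_mat n m" "B \<in> carrier_mat n m"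
  shows "frobenius_sq (A - B) = frobenius_sq (B - A)"
  using assms by (auto simp: frobenius_sq_def norm_minus_commute intro!: sum.cong)

text \<open>The unknown \<open>\<rho>\<close> itself witnesses that some state lies within
  \<open>r\<close> of \<open>X\<close>, so the chosen state does too, though the choice depends on
  \<open>X\<close> and \<open>r\<close> alone. Passing through \<open>X\<close> costs 2 r + 2 r,
  hence the factor 4.\<close>

lemma trace_norm_nearby_state_le:
  assumes \<rho>: "density_operator d \<rho>" and X: "X \<in> carrier_mat d d" and near: "frobenius_sq (X - \<rho>) \<le> r"
  shows "(trace_norm (nearby_state d r X - \<rho>))\<^sup>2 \<le> 4 * real d * r"
proof -
  have \<rho>c: "\<rho> \<in> carrier_mat d d" and \<rho>h: "mat_adjoint \<rho> = \<rho>"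
    using \<rho> by (auto simp: density_operator_def pos_semidef_def)
  have "0 < d"
  proof (rule ccontr)
    assume "\<not> 0 < d"
    then have "mat_trace \<rho> = 0" using \<rho>c by (simp add: mat_trace_def)
    then show False using \<rho> by (simp add: density_operator_def)
  qed
  define \<sigma> where "\<sigma> = nearby_state d r X"
  have \<sigma>: "density_operator d \<sigma>" unfolding \<sigma>_def by (rule nearby_state(1)[OF \<open>0 < d\<close>])
  then have \<sigma>c: "\<sigma> \<in> carrier_mat d d" and \<sigma>h: "mat_adjoint \<sigma> = \<sigma>"
    by (auto simp: density_operator_def pos_semidef_def)
  have "frobenius_sq (\<rho> - X) \<le> r" using near frobenius_sq_minus_commute[OF X \<rho>c] by simp
  then have \<sigma>near: "frobenius_sq (\<sigma> - X) \<le> r"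
    unfolding \<sigma>_def by (rule nearby_state(2)[OF \<open>0 < d\<close> \<rho>])
  have \<sigma>\<rho>: "\<sigma> - \<rho> \<in> carrier_mat d d" by (rule minus_carrier_mat[OF \<rho>c])
  have herm: "mat_adjoint (\<sigma> - \<rho>) = \<sigma> - \<rho>"
  proof (rule eq_matI)
    fix i j assume "i < dim_row (\<sigma> - \<rho>)" "j < dim_col (\<sigma> - \<rho>)"
    then have ij: "i < d" "j < d" using \<sigma>\<rho> by auto
    have "mat_adjoint (\<sigma> - \<rho>) $$ (i, j) = cnj ((\<sigma> - \<rho>) $$ (j, i))"
      using ij \<sigma>\<rho> by (intro mat_adjoint_index) auto
    also have "\<dots> = (\<sigma> - \<rho>) $$ (i, j)"
      using ij \<sigma>c \<rho>c hermitian_index[OF \<sigma>c \<sigma>h ij] hermitian_index[OF \<rho>c \<rho>h ij] by simp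
    finally show "mat_adjoint (\<sigma> - \<rho>) $$ (i, j) = (\<sigma> - \<rho>) $$ (i, j)" .
  qed (use \<sigma>c \<rho>c in auto)
  have "\<sigma> - \<rho> = (\<sigma> - X) + (X - \<rho>)"
    by (rule eq_matI) (use \<sigma>c \<rho>c X in auto)
  then have "frobenius_sq (\<sigma> - \<rho>) \<le> 2 * frobenius_sq (\<sigma> - X) + 2 * frobenius_sq (X - \<rho>)"
    using frobenius_sq_add_le[OF minus_carrier_mat[OF X] minus_carrier_mat[OF \<rho>c]] by metis
  also have "\<dots> \<le> 4 * r" using \<sigma>near near by simp
  finally have "real d * frobenius_sq (\<sigma> - \<rho>) \<le> real d * (4 * r)" by (rule mult_left_mono) simp
  with trace_norm_hermitian_le[OF \<sigma>\<rho> herm] show ?thesis unfolding \<sigma>_def by (simp add: mult_ac)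
qed

section \<open>The algorithm and its success probability\<close>

abbreviation pauli_povms :: "nat \<Rightarrow> nat \<Rightarrow> complex mat list" where
  "pauli_povms \<equiv> \<lambda>i j. map pauli_effect [0..<6]"

definition linear_inversion :: "nat \<Rightarrow> nat \<Rightarrow> (nat \<Rightarrow> nat \<Rightarrow> nat) \<Rightarrow> complex mat" where
  "linear_inversion m n w =
     mat (2 ^ m) (2 ^ m) (\<lambda>(c, d). (\<Sum>i<n. pauli_duals m (w i) $$ (c, d)) / of_nat n)"

lemma joint_outcomes_pauli: "joint_outcomes m n pauli_povms = {..<n} \<rightarrow>\<^sub>E pauli_outcomes m"
  unfolding joint_outcomes_def pauli_outcomes_def by simp

text \<open>The copies are independent samples: effect and state are both tensor products over the
  copies, so the trace of their product factors.\<close>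

lemma born_prob_pauli:
  assumes \<rho>: "pos_semidef (2 ^ m) \<rho>" and w: "w \<in> {..<n} \<rightarrow>\<^sub>E pauli_outcomes m"
  shows "born_prob (joint_effect m n pauli_povms w) (tensor_list (replicate n \<rho>)) =
    (\<Prod>i<n. Re (pauli_prob m \<rho> (w i)))"
proof -
  have \<rho>c: "\<rho> \<in> carrier_mat (2 ^ m) (2 ^ m)" using \<rho> by (simp add: pos_semidef_def)
  have "map pauli_effect [0..<6] ! w i j = pauli_effect (w i j)" if "i < n" "j < m" for i j
  proof -
    have "w i \<in> pauli_outcomes m" using w that by auto
    then have "w i j < 6" using that by (auto simp: pauli_outcomes_def)
    then show ?thesis by (simp del: upt_Suc)
  qed
  then have "joint_effect m n pauli_povms w = tensor_list (map (\<lambda>i. pauli_effects m (w i)) [0..<n])"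
    unfolding joint_effect_def pauli_effects_def
    by (intro arg_cong[where f = tensor_list] map_cong refl) auto
  moreover have "replicate n \<rho> = map (\<lambda>_. \<rho>) [0..<n]" by (simp add: map_replicate_const)
  ultimately have "mat_trace (joint_effect m n pauli_povms w * tensor_list (replicate n \<rho>)) =
      (\<Prod>i<n. pauli_prob m \<rho> (w i))"
    unfolding pauli_prob_def prod_list_upt[symmetric]
    using mat_trace_tensor_list_mult[of "[0..<n]" "\<lambda>i. pauli_effects m (w i)" "2 ^ m" "\<lambda>_. \<rho>"]
      pauli_effects_carrier \<rho>c by simp
  \<comment> \<open>Each factor is real by nonnegativity in the complex order; the real part of a
    product could not be split otherwise.\<close>
  also have "\<dots> = (\<Prod>i<n. complex_of_real (Re (pauli_prob m \<rho> (w i))))"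
    using pauli_prob_nonneg[OF \<rho>] by (intro prod.cong refl) (simp add: less_eq_complex_def complex_eq_iff)
  also have "\<dots> = complex_of_real (\<Prod>i<n. Re (pauli_prob m \<rho> (w i)))" by simp
  finally show ?thesis unfolding born_prob_def by (simp only: Re_complex_of_real)
qed

text \<open>The mean error bound is applied to each matrix entry separately; summed over the
  entries, the second moments reassemble to the constant norm \<open>5 ^ m\<close> of the
  duals.\<close>

lemma linear_inversion_mean_error:
  assumes \<rho>: "density_operator (2 ^ m) \<rho>" and n: "n > 0"
  shows "(\<Sum>w\<in>{..<n} \<rightarrow>\<^sub>E pauli_outcomes m.
      (\<Prod>i<n. Re (pauli_prob m \<rho> (w i))) * frobenius_sq (linear_inversion m n w - \<rho>)) \<le> 5 ^ m / real n"
proof -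
  have pos: "pos_semidef (2 ^ m) \<rho>" and tr: "mat_trace \<rho> = 1"
    using \<rho> by (auto simp: density_operator_def)
  then have \<rho>c: "\<rho> \<in> carrier_mat (2 ^ m) (2 ^ m)" by (simp add: pos_semidef_def)
  define q where "q u = Re (pauli_prob m \<rho> u)" for u
  have q: "pauli_prob m \<rho> u = of_real (q u)" for u
    using pauli_prob_nonneg[OF pos, of u] by (simp add: q_def less_eq_complex_def complex_eq_iff)
  have q0: "0 \<le> q u" for u
    using pauli_prob_nonneg[OF pos, of u] by (simp add: q_def less_eq_complex_def)
  have q1: "(\<Sum>u\<in>pauli_outcomes m. q u) = 1"
    using sum_pauli_prob[OF \<rho>c] unfolding q tr of_real_sum[symmetric] by (simp only: of_real_eq_1_iff)
  let ?W = "{..<n} \<rightarrow>\<^sub>E pauli_outcomes m"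
  have "(\<Sum>w\<in>?W. (\<Prod>i<n. q (w i)) * frobenius_sq (linear_inversion m n w - \<rho>)) =
      (\<Sum>w\<in>?W. \<Sum>c<2 ^ m. \<Sum>d<2 ^ m. (\<Prod>i<n. q (w i)) *
        (cmod ((\<Sum>i<n. pauli_duals m (w i) $$ (c, d)) / of_nat n - \<rho> $$ (c, d)))\<^sup>2)"
    unfolding frobenius_sq_def sum_distrib_left
    using \<rho>c by (intro sum.cong refl) (auto simp: linear_inversion_def sum_distrib_left)
  also have "\<dots> = (\<Sum>c<2 ^ m. \<Sum>d<2 ^ m. \<Sum>w\<in>?W. (\<Prod>i<n. q (w i)) *
        (cmod ((\<Sum>i<n. pauli_duals m (w i) $$ (c, d)) / of_nat n - \<rho> $$ (c, d)))\<^sup>2)"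
    by (subst sum.swap, intro sum.cong refl, rule sum.swap)
  also have "\<dots> \<le> (\<Sum>c<2 ^ m. \<Sum>d<2 ^ m.
      (\<Sum>u\<in>pauli_outcomes m. q u * (cmod (pauli_duals m u $$ (c, d)))\<^sup>2) / real n)"
    using sum_pauli_prob_dual[OF \<rho>c]
    by (intro sum_mono product_weight_mean_error n q1) (auto simp: q)
  also have "\<dots> = (\<Sum>c<2 ^ m. \<Sum>d<2 ^ m.
      \<Sum>u\<in>pauli_outcomes m. q u * (cmod (pauli_duals m u $$ (c, d)))\<^sup>2) / real n"
    by (simp only: sum_divide_distrib)
  also have "(\<Sum>c<2 ^ m. \<Sum>d<2 ^ m. \<Sum>u\<in>pauli_outcomes m. q u * (cmod (pauli_duals m u $$ (c, d)))\<^sup>2) =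
      (\<Sum>u\<in>pauli_outcomes m. \<Sum>c<2 ^ m. \<Sum>d<2 ^ m. q u * (cmod (pauli_duals m u $$ (c, d)))\<^sup>2)"
    by (subst (2) sum.swap, intro sum.cong refl, rule sum.swap)
  also have "\<dots> = (\<Sum>u\<in>pauli_outcomes m. q u * frobenius_sq (pauli_duals m u))"
    using pauli_duals_carrier[of m]
    by (intro sum.cong refl) (simp add: frobenius_sq_def sum_distrib_left carrier_matD[OF pauli_duals_carrier])
  also have "\<dots> = 5 ^ m"
    using q1 by (simp add: frobenius_sq_pauli_duals flip: sum_distrib_right)
  finally show ?thesis unfolding q_def .
qed

text \<open>Markov's inequality for the squared Frobenius error. The event \<open>P\<close> is left
  general and only has to contain all outcomes with error at most \<open>r\<close>.\<close>

lemma streaming_prob_linear_inversion: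
  assumes \<rho>: "density_operator (2 ^ m) \<rho>" and n: "n > 0" and r: "r > 0"
    and P: "\<And>w. frobenius_sq (linear_inversion m n w - \<rho>) \<le> r \<Longrightarrow> P w"
  shows "1 - 5 ^ m / (real n * r) \<le> streaming_prob m n pauli_povms \<rho> P"
proof -
  have pos: "pos_semidef (2 ^ m) \<rho>" and tr: "mat_trace \<rho> = 1"
    using \<rho> by (auto simp: density_operator_def)
  then have \<rho>c: "\<rho> \<in> carrier_mat (2 ^ m) (2 ^ m)" by (simp add: pos_semidef_def)
  let ?W = "{..<n} \<rightarrow>\<^sub>E pauli_outcomes m"
  define p where "p w = (\<Prod>i<n. Re (pauli_prob m \<rho> (w i)))" for w :: "nat \<Rightarrow> nat \<Rightarrow> nat"
  define D where "D w = frobenius_sq (linear_inversion m n w - \<rho>)" for w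
  have finW: "finite ?W" by (rule finite_PiE) auto
  have p0: "0 \<le> p w" for w
    unfolding p_def using pauli_prob_nonneg[OF pos] by (intro prod_nonneg) (auto simp: less_eq_complex_def)
  have D0: "0 \<le> D w" for w unfolding D_def frobenius_sq_def by (intro sum_nonneg) auto
  have "(\<Sum>w\<in>?W. p w) = (\<Prod>i<n. \<Sum>u\<in>pauli_outcomes m. Re (pauli_prob m \<rho> u))"
    unfolding p_def by (rule prod_sum_PiE[symmetric]) auto
  also have "\<dots> = 1"
    using sum_pauli_prob[OF \<rho>c] unfolding Re_sum[symmetric] tr by simp
  finally have p1: "(\<Sum>w\<in>?W. p w) = 1" .
  have "1 - (\<Sum>w\<in>{w\<in>?W. P w}. p w) = (\<Sum>w\<in>{w\<in>?W. \<not> P w}. p w)"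
  proof -
    have "(\<Sum>w\<in>?W. p w) = (\<Sum>w\<in>{w\<in>?W. P w}. p w) + (\<Sum>w\<in>{w\<in>?W. \<not> P w}. p w)"
      using finW by (subst sum.union_disjoint[symmetric]) (auto intro!: sum.cong)
    then show ?thesis using p1 by simp
  qed
  also have "\<dots> \<le> (\<Sum>w\<in>{w\<in>?W. \<not> P w}. p w * D w / r)"
  proof (intro sum_mono)
    fix w assume "w \<in> {w\<in>?W. \<not> P w}"
    then have "r \<le> D w" using P[of w] by (cases "D w \<le> r") (auto simp: D_def)
    then have "p w * r \<le> p w * D w" using p0 by (intro mult_left_mono)
    then show "p w \<le> p w * D w / r" using r by (simp add: pos_le_divide_eq)
  qed
  also have "\<dots> \<le> (\<Sum>w\<in>?W. p w * D w / r)"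
    using finW p0 D0 r by (intro sum_mono2) auto
  also have "\<dots> \<le> 5 ^ m / real n / r"
    unfolding sum_divide_distrib[symmetric] p_def D_def
    using linear_inversion_mean_error[OF \<rho> n] r by (intro divide_right_mono) auto
  finally have "1 - 5 ^ m / (real n * r) \<le> (\<Sum>w\<in>{w\<in>?W. P w}. p w)" by simp
  also have "\<dots> = streaming_prob m n pauli_povms \<rho> P"
    unfolding streaming_prob_def joint_outcomes_pauli p_def
    using born_prob_pauli[OF pos] by (intro sum.cong refl) auto
  finally show ?thesis .
qed

theorem theorem1p2p3:
  shows "\<exists>K::real. \<forall>m::nat. \<forall>\<epsilon>::real. m \<ge> 1 \<longrightarrow> 0 < \<epsilon> \<longrightarrow> \<epsilon> \<le> 1 \<longrightarrow>
    (\<exists>(n::nat) E est.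
       real n \<le> K * 18 ^ m / \<epsilon>\<^sup>2 \<and>
       streaming_tomography_algorithm m n E est \<and>
       (\<forall>\<rho>. density_operator (2 ^ m) \<rho> \<longrightarrow>
          streaming_prob m n E \<rho> (\<lambda>w. trace_norm (est w - \<rho>) \<le> \<epsilon>) \<ge> 2 / 3))"
proof (intro exI[of _ "13::real"] allI impI)
  fix m :: nat and \<epsilon> :: real
  assume \<epsilon>: "0 < \<epsilon>" "\<epsilon> \<le> 1"
  \<comment> \<open>12 = 3 * 4: the failure bound \<open>5 ^ m / (real n * r)\<close> equals 4 *
    10^m divided by \<open>real n * \<epsilon>\<^sup>2\<close> and has to be at most 1/3.\<close>
  define n where "n = nat \<lceil>12 * 10 ^ m / \<epsilon>\<^sup>2\<rceil>"
  \<comment> \<open>Chosen so that the bound 4 * 2^m * r on the squared trace norm is exactly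
    \<open>\<epsilon>\<^sup>2\<close>.\<close>
  define r where "r = \<epsilon>\<^sup>2 / (4 * 2 ^ m)"
  define est where "est w = nearby_state (2 ^ m) r (linear_inversion m n w)" for w
  have \<epsilon>2: "0 < \<epsilon>\<^sup>2" "\<epsilon>\<^sup>2 \<le> 1" using \<epsilon> by (auto simp: power_le_one)
  have big: "1 \<le> 10 ^ m / \<epsilon>\<^sup>2"
    using \<epsilon>2 order_trans[OF \<epsilon>2(2) one_le_power[of "10::real" m]] by (simp add: pos_le_divide_eq)
  have n_ge: "12 * 10 ^ m / \<epsilon>\<^sup>2 \<le> real n" unfolding n_def by linarith
  have "real n \<le> 12 * 10 ^ m / \<epsilon>\<^sup>2 + 1" unfolding n_def using big by linarith
  \<comment> \<open>The 1 from rounding up is absorbed by \<open>big\<close>, which uses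
    \<open>\<epsilon> \<le> 1\<close>; this turns 12 into the constant 13.\<close>
  also have "\<dots> \<le> 13 * (10 ^ m / \<epsilon>\<^sup>2)" using big by linarith
  also have "\<dots> \<le> 13 * 18 ^ m / \<epsilon>\<^sup>2"
    using \<epsilon>2 power_mono[of "10::real" 18 m] by (simp add: divide_right_mono)
  finally have n_le: "real n \<le> 13 * 18 ^ m / \<epsilon>\<^sup>2" .
  have n0: "n > 0" using n_ge big by (cases n) auto
  have r0: "r > 0" using \<epsilon>2 by (simp add: r_def)
  have "streaming_tomography_algorithm m n pauli_povms est"
    unfolding streaming_tomography_algorithm_def est_def
    using povm_pauli nearby_state(1)[of "2 ^ m"] by auto
  moreover have "2 / 3 \<le> streaming_prob m n pauli_povms \<rho> (\<lambda>w. trace_norm (est w - \<rho>) \<le> \<epsilon>)"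
    if \<rho>: "density_operator (2 ^ m) \<rho>" for \<rho>
  proof -
    have good: "trace_norm (est w - \<rho>) \<le> \<epsilon>" if "frobenius_sq (linear_inversion m n w - \<rho>) \<le> r" for w
    proof -
      have "(trace_norm (est w - \<rho>))\<^sup>2 \<le> 4 * real (2 ^ m) * r"
        unfolding est_def using that
        by (intro trace_norm_nearby_state_le[OF \<rho>]) (simp_all add: linear_inversion_def)
      also have "\<dots> = \<epsilon>\<^sup>2" by (simp add: r_def)
      finally show ?thesis by (rule power2_le_imp_le) (use \<epsilon> in simp)
    qed
    have "5 ^ m / r = 4 * 10 ^ m / \<epsilon>\<^sup>2"
      by (simp add: r_def flip: power_mult_distrib)
    also have "\<dots> \<le> real n / 3" using n_ge by simp
    finally have "5 ^ m / (real n * r) \<le> 1 / 3"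
      using n0 r0 by (simp add: field_simps)
    moreover have "1 - 5 ^ m / (real n * r) \<le>
        streaming_prob m n pauli_povms \<rho> (\<lambda>w. trace_norm (est w - \<rho>) \<le> \<epsilon>)"
      using good by (rule streaming_prob_linear_inversion[OF \<rho> n0 r0])
    ultimately show ?thesis by linarith
  qed
  ultimately show "\<exists>(n::nat) E est.
       real n \<le> 13 * 18 ^ m / \<epsilon>\<^sup>2 \<and>
       streaming_tomography_algorithm m n E est \<and>
       (\<forall>\<rho>. density_operator (2 ^ m) \<rho> \<longrightarrow>
          streaming_prob m n E \<rho> (\<lambda>w. trace_norm (est w - \<rho>) \<le> \<epsilon>) \<ge> 2 / 3)"
    using n_le by blast
qed

end
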